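(* Let $\mathfrak g$ be of type $A_n$ or $C_n$. The set $\mathcal R^\infty$, together with the maps $\mathrm{wt}$, $\tilde e_l$, $\tilde f_l$, $\epsilon_l$, $\varphi_l$ ($l\in I$) defined in the context, is a semiregular crystal.
   Context: **Lie algebra.** $\mathfrak g$ is the complex simple Lie algebra of type $A_n$ ($\mathfrak{sl}_{n+1}$) or $C_n$ ($\mathfrak{sp}_{2n}$), $I=\{1,\dots,n\}$, with simple roots $\alpha_l$, simple coroots $\alpha_l^\vee$, fundamental weights $\omega_l$ (standard numbering; in type $C_n$ the root $\alpha_n$ is long), $P=\bigoplus_{i}\mathbb Z\omega_i$. Put $\alpha_{i,j}=\alpha_i+\alpha_{i+1}+\dots+\alpha_j$ for $1\le i\le j\le n$, and in type $C_n$ also $\alpha_{i,\overline j}=\alpha_i+\alpha_{i+1}+\dots+\alpha_n+\alpha_{n-1}+\dots+\alpha_j$ for $1\le i\le j\le n$. **Crystals.** A crystal is a set $B$ with maps $\mathrm{wt}:B\to P$, $\tilde e_l,\tilde f_l:B\to B\cup\{0\}$, $\epsilon_l,\varphi_l:B\to\mathbb Z\cup\{-\infty\}$ ($l\in I$) such that: $\varphi_l(b)=\epsilon_l(b)+\langle\alpha_l^\vee,\mathrm{wt}(b)\rangle$; if $\tilde e_lb\in B$ then $\mathrm{wt}(\tilde e_lb)=\mathrm{wt}(b)+\alpha_l$, $\epsilon_l(\tilde e_lb)=\epsilon_l(b)-1$, $\varphi_l(\tilde e_lb)=\varphi_l(b)+1$; if $\tilde f_lb\in B$ then $\mathrm{wt}(\tilde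 f_lb)=\mathrm{wt}(b)-\alpha_l$, $\epsilon_l(\tilde f_lb)=\epsilon_l(b)+1$, $\varphi_l(\tilde f_lb)=\varphi_l(b)-1$; $\tilde f_lb=b'$ iff $\tilde e_lb'=b$ for $b,b'\in B$; if $\varphi_l(b)=-\infty$ then $\tilde e_lb=\tilde f_lb=0$. It is semiregular if $\epsilon_l(b)=\max\{k\ge0:\tilde e_l^kb\ne0\}$ and $\varphi_l(b)=\max\{k\ge0:\tilde f_l^kb\ne0\}$ for all $b\in B$, $l\in I$. **Index set.** $\mathbf I=\{1<2<\dots<n\}$ in type $A_n$, and $\mathbf I=\{1<2<\dots<n<\overline{n-1}<\dots<\overline1\}$ in type $C_n$. In type $C_n$ the bar is the involution of $\mathbf I$ with $\overline n=n$, $i\leftrightarrow\overline i$ for $1\le i\le n-1$. **Sequences.** For $1\le i\le n$, $s\ge0$, $\mathcal R^i_s$ is the set of sequences $(i_1,i_1')\cdots(i_s,i_s')$ with entries in $\mathbf I$ such that $1\le i_s<i_{s-1}<\dots<i_1\le i\le i_1'<i_2'<\dots<i_s'\le\max\mathbf I$ and, in type $C_n$, $i_j'\le\overline{i_j}$ for $j=1,\dots,s$. $\emptyset_i$ is the unique element of $\mathcal R^i_0$. Elements of $\mathcal R^i_s$ for different $i$ are regarded as distinct. $\mathcal R=\bigsqcup_{i,s}\mathcal R^i_s\sqcup\{0\}$, and $\mathcal R^\infty$ is the set of infinite sequences $\mathbf x=(x_1,x_2,\dots)$ with $x_j\in\mathcal R$ and only finitely many $x_j\ne0$ (each $\emptyset_i$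 counts as non-zero; the component symbol $0$ is not the crystal symbol $0$). **Properties.** Let $x=(i_1,i_1')\cdots(i_s,i_s')\in\mathcal R^i_s$, $X=\{i_1,\dots,i_s\}$, $X'=\{i_1',\dots,i_s'\}$, $l\in I$. Convention: in type $A_n$ (all $l$) and in type $C_n$ for $l=n$, the statements "$\overline l\in X'$" and "$\overline{l+1}\in X'$" below are regarded as false. - (a): $l\notin X\cup X'$; and [$l+1\in X$ if $l<i$; $l-1\in X'$ if $l>i$; no condition if $l=i$]; and ($\overline{l+1}\in X'$ or $\overline l\notin X'$). - (a'): as (a), with the last clause replaced by ($\overline{l+1}\in X'$ and $\overline l\notin X'$). - (b): $\overline l\notin X'$, $\overline{l+1}\in X'$; and [$l+1\notin X$ or $l\in X$, if $l<i$; $l-1\notin X'$ or $l\in X'$, if $l>i$; $l=i_1$ or $l=i_1'$, if $l=i$]. - (c): $l\in X\cup X'$; and [$l+1\notin X$ if $l<i$; $l-1\notin X'$ if $l>i$; $(i_1,i_1')=(l,l)$ if $l=i$]; and ($\overline{l+1}\in X'$ or $\overline l\notin X'$). - (d): $\overline l\in X'$, $\overline{l+1}\notin X'$; and [$l+1\notin X$ or $l\in X$, if $l<i$; $l-1\notin X'$ or $l\in X'$, if $l>i$; $l=i_1$ or $l=i_1'$, if $l=i$]. - (d'): as (d), with every "or" replaced by "and". **Maps $\theta_l,\rho_l$.** For $x\in\mathcal R^i_s$: if $x$ satisfies (a), $\theta_l(x)$ arises from $x$ by replacing $l+1$ by $l$ among the $i_k$ (if $l<i$), replacing $l-1$ by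 $l$ among the $i_k'$ (if $l>i$), adding the pair $(l,l)$ (if $l=i$); if $x$ satisfies (b), $\theta_l(x)$ arises by replacing $\overline{l+1}$ by $\overline l$; otherwise $\theta_l(x)=0$. If $x$ satisfies (c), $\rho_l(x)$ arises by replacing $l$ by $l+1$ among the $i_k$ (if $l<i$), $l$ by $l-1$ among the $i_k'$ (if $l>i$), erasing $(l,l)$ (if $l=i$); if $x$ satisfies (d), $\rho_l(x)$ arises by replacing $\overline l$ by $\overline{l+1}$; otherwise $\rho_l(x)=0$. The results have the same superscript $i$. **Crystal structure on $\mathcal R^\infty$.** Let $x_{q_1},\dots,x_{q_k}$ ($q_1<\dots<q_k$) be the non-zero components of $\mathbf x$. Put $\mathrm{wt}(\mathbf x)=\sum_{i=1}^nc_i\omega_i-\sum_j\mathrm{wt}(x_j)$, with $c_i$ the number of components in $\bigsqcup_s\mathcal R^i_s$, $\mathrm{wt}((i_1,i_1')\cdots(i_s,i_s'))=\sum_{r}\alpha_{i_r,i_r'}$, $\mathrm{wt}(0)=\mathrm{wt}(\emptyset_i)=0$. Put $\sigma_l^1=\tau_l^1=0$; for $2\le j\le k+1$, $\sigma_l^j(\mathbf x)=\sharp\{1\le p\le j-1: x_{q_p}\text{ satisfies (a) or (b)}\}+\sharp\{1\le p\le j-1:x_{q_p}\text{ satisfies (a')}\}$; for $2\le j\le k$, $\tau_l^j(\mathbf x)=\sharp\{2\le p\le j:x_{q_p}\text{ satisfies (c) or (d)}\}+\sharp\{2\le p\le j:x_{q_p}\text{ satisfies (d')}\}$. Let $\mu_l=\min_{1\le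 j\le k}(\sigma_l^j(\mathbf x)-\tau_l^j(\mathbf x))$, and let $f_l(\mathbf x)$ (resp. $e_l(\mathbf x)$) be the largest (resp. smallest) $p\in\{1,\dots,k\}$ with $\sigma_l^p(\mathbf x)-\tau_l^p(\mathbf x)=\mu_l$. Then $\tilde f_l\mathbf x$ is obtained by replacing the component $x_{q_p}$, $p=f_l(\mathbf x)$, by $\theta_l(x_{q_p})$ if this is $\ne0$, and $\tilde f_l\mathbf x=0$ otherwise; $\tilde e_l\mathbf x$ is obtained by replacing $x_{q_p}$, $p=e_l(\mathbf x)$, by $\rho_l(x_{q_p})$ if this is $\neq0$, and $\tilde e_l\mathbf x=0$ otherwise. Finally $\epsilon_l(\mathbf x)=\tau_l^2((\emptyset_1,x_{q_1},0,0,\dots))-\mu_l$ and $\varphi_l(\mathbf x)=\sigma_l^{k+1}(\mathbf x)-\tau_l^k(\mathbf x)-\mu_l$. For $\mathbf x=(0,0,\dots)$ put $\tilde e_l\mathbf x=\tilde f_l\mathbf x=0$, $\epsilon_l(\mathbf x)=\varphi_l(\mathbf x)=0$. *)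

theory Defs
  imports Main "HOL-Library.Extended" "HOL-Library.Poly_Mapping"
begin

text \<open>
  \<open>TypeA n\<close> stands for \<open>sl(n+1)\<close> and \<open>TypeC n\<close> for \<open>sp(2n)\<close>. The Lie algebra enters only
  through its Cartan matrix.
\<close>

datatype cartan_type = TypeA nat | TypeC nat

fun lie_rank :: "cartan_type \<Rightarrow> nat" where
  "lie_rank (TypeA n) = n"
| "lie_rank (TypeC n) = n"

definition index_set :: "cartan_type \<Rightarrow> nat set" where
  "index_set g = {1..lie_rank g}"

text \<open>
  \<open>cartan g i j\<close> is the value of the \<open>i\<close>-th simple coroot on the \<open>j\<close>-th simple root. In type
  \<open>C\<close> the last simple root is long, so the entry \<open>-2\<close> is in row \<open>n - 1\<close> and column \<open>n\<close>.
\<close>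

definition cartan :: "cartan_type \<Rightarrow> nat \<Rightarrow> nat \<Rightarrow> int" where
  "cartan g i j =
    (if i = j then 2
     else if (\<exists>n. g = TypeC n \<and> i + 1 = n \<and> j = n) then -2
     else if i + 1 = j \<or> j + 1 = i then -1
     else 0)"

text \<open>
  The weight lattice is the free abelian group on the fundamental weights, so the value of the
  \<open>l\<close>-th simple coroot on a weight is its \<open>l\<close>-th coordinate.
\<close>

type_synonym weight = "nat \<Rightarrow>\<^sub>0 int"

definition fundamental_weight :: "nat \<Rightarrow> weight" where
  "fundamental_weight i = Poly_Mapping.single i 1"

definition weight_lattice :: "cartan_type \<Rightarrow> weight set" where
  "weight_lattice g = {w. Poly_Mapping.keys w \<subseteq> index_set g}"

definition coroot_pairing :: "nat \<Rightarrow> weight \<Rightarrow> int" where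
  "coroot_pairing l w = Poly_Mapping.lookup w l"

definition simple_root :: "cartan_type \<Rightarrow> nat \<Rightarrow> weight" where
  "simple_root g j = (\<Sum>i\<in>index_set g. frag_cmul (cartan g i j) (fundamental_weight i))"

text \<open>
  The crystal symbol \<open>0\<close> is \<open>None\<close>. The values of \<open>eps\<close> and
  \<open>phi\<close> are integers or \<open>-\<infinity>\<close>, hence the exclusion of \<open>Pinf\<close>.
\<close>

locale crystal =
  fixes g :: cartan_type
    and B :: "'b set"
    and wt :: "'b \<Rightarrow> weight"
    and e f :: "nat \<Rightarrow> 'b \<Rightarrow> 'b option"
    and eps phi :: "nat \<Rightarrow> 'b \<Rightarrow> int extended"
  assumes wt_mem: "b \<in> B \<Longrightarrow> wt b \<in> weight_lattice g"
    and e_mem: "l \<in> index_set g \<Longrightarrow> b \<in> B \<Longrightarrow> e l b = Some b' \<Longrightarrow> b' \<in> B"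
    and f_mem: "l \<in> index_set g \<Longrightarrow> b \<in> B \<Longrightarrow> f l b = Some b' \<Longrightarrow> b' \<in> B"
    and eps_not_Pinf: "l \<in> index_set g \<Longrightarrow> b \<in> B \<Longrightarrow> eps l b \<noteq> Pinf"
    and phi_not_Pinf: "l \<in> index_set g \<Longrightarrow> b \<in> B \<Longrightarrow> phi l b \<noteq> Pinf"
    and phi_eq: "l \<in> index_set g \<Longrightarrow> b \<in> B \<Longrightarrow>
      phi l b = eps l b + Fin (coroot_pairing l (wt b))"
    and wt_e: "l \<in> index_set g \<Longrightarrow> b \<in> B \<Longrightarrow> e l b = Some b' \<Longrightarrow>
      wt b' = wt b + simple_root g l"
    and eps_e: "l \<in> index_set g \<Longrightarrow> b \<in> B \<Longrightarrow> e l b = Some b' \<Longrightarrow> eps l b' = eps l b - Fin 1"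
    and phi_e: "l \<in> index_set g \<Longrightarrow> b \<in> B \<Longrightarrow> e l b = Some b' \<Longrightarrow> phi l b' = phi l b + Fin 1"
    and wt_f: "l \<in> index_set g \<Longrightarrow> b \<in> B \<Longrightarrow> f l b = Some b' \<Longrightarrow>
      wt b' = wt b - simple_root g l"
    and eps_f: "l \<in> index_set g \<Longrightarrow> b \<in> B \<Longrightarrow> f l b = Some b' \<Longrightarrow> eps l b' = eps l b + Fin 1"
    and phi_f: "l \<in> index_set g \<Longrightarrow> b \<in> B \<Longrightarrow> f l b = Some b' \<Longrightarrow> phi l b' = phi l b - Fin 1"
    and f_iff_e: "l \<in> index_set g \<Longrightarrow> b \<in> B \<Longrightarrow> b' \<in> B \<Longrightarrow>
      f l b = Some b' \<longleftrightarrow> e l b' = Some b"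
    and phi_Minf: "l \<in> index_set g \<Longrightarrow> b \<in> B \<Longrightarrow> phi l b = Minf \<Longrightarrow>
      e l b = None \<and> f l b = None"

definition iterate_op :: "('b \<Rightarrow> 'b option) \<Rightarrow> nat \<Rightarrow> 'b \<Rightarrow> 'b option" where
  "iterate_op h k b = ((\<lambda>y. Option.bind y h) ^^ k) (Some b)"

text \<open>Finiteness is required because \<open>Max\<close> is meaningless on infinite sets.\<close>

definition has_max_value :: "int extended \<Rightarrow> nat set \<Rightarrow> bool" where
  "has_max_value v S \<longleftrightarrow> finite S \<and> v = Fin (int (Max S))"

locale semiregular_crystal = crystal +
  assumes eps_max: "l \<in> index_set g \<Longrightarrow> b \<in> B \<Longrightarrow>
      has_max_value (eps l b) {k. iterate_op (e l) k b \<noteq> None}"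
    and phi_max: "l \<in> index_set g \<Longrightarrow> b \<in> B \<Longrightarrow>
      has_max_value (phi l b) {k. iterate_op (f l) k b \<noteq> None}"

text \<open>
  The ordered index set \<open>1 < ... < n < bar (n-1) < ... < bar 1\<close> of type \<open>C\<close> is encoded as
  \<open>1 < ... < 2n - 1\<close>, with \<open>bar j\<close> encoded as \<open>2n - j\<close>; the order and the involution
  become those of the natural numbers. The value in type \<open>A\<close> is never used.
\<close>

fun max_index :: "cartan_type \<Rightarrow> nat" where
  "max_index (TypeA n) = n"
| "max_index (TypeC n) = 2 * n - 1"

fun bar :: "cartan_type \<Rightarrow> nat \<Rightarrow> nat" where
  "bar (TypeC n) j = 2 * n - j"
| "bar (TypeA n) j = j"

text \<open>
  A sequence is tagged with its superscript \<open>i\<close>, so that sequences with different superscripts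
  are distinct.
\<close>

type_synonym rseq = "nat \<times> (nat \<times> nat) list"

definition Rset :: "cartan_type \<Rightarrow> nat \<Rightarrow> nat \<Rightarrow> rseq set" where
  "Rset g i s = {(i, ps) | ps.
     length ps = s \<and>
     sorted_wrt (>) (map fst ps) \<and> sorted_wrt (<) (map snd ps) \<and>
     (\<forall>(a, a') \<in> set ps. 1 \<le> a \<and> a \<le> i \<and> i \<le> a' \<and> a' \<le> max_index g) \<and>
     (\<forall>n. g = TypeC n \<longrightarrow> (\<forall>(a, a') \<in> set ps. a' \<le> bar g a))}"

text \<open>The component symbol \<open>0\<close> is \<open>None\<close>. The component \<open>x\<^sub>j\<close>, \<open>j \<ge> 1\<close>, is \<open>x (j - 1)\<close>.\<close>

definition Rcomp :: "cartan_type \<Rightarrow> rseq option set" where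
  "Rcomp g = (\<Union>i\<in>index_set g. \<Union>s. Some ` Rset g i s) \<union> {None}"

definition Rinf :: "cartan_type \<Rightarrow> (nat \<Rightarrow> rseq option) set" where
  "Rinf g = {x. (\<forall>j. x j \<in> Rcomp g) \<and> finite {j. x j \<noteq> None}}"

abbreviation lefts :: "(nat \<times> nat) list \<Rightarrow> nat set" where
  "lefts ps \<equiv> fst ` set ps"

abbreviation rights :: "(nat \<times> nat) list \<Rightarrow> nat set" where
  "rights ps \<equiv> snd ` set ps"

text \<open>
  \<open>bar_in\<close> and \<open>bar_Suc_in\<close> express that \<open>bar l\<close>, respectively \<open>bar (l+1)\<close>, is in \<open>X'\<close>.
  Both are false by convention in type \<open>A\<close>, and in type \<open>C\<close> for \<open>l = n\<close>.
\<close>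

fun bar_in :: "cartan_type \<Rightarrow> nat \<Rightarrow> (nat \<times> nat) list \<Rightarrow> bool" where
  "bar_in (TypeA n) l ps \<longleftrightarrow> False"
| "bar_in (TypeC n) l ps \<longleftrightarrow> l \<noteq> n \<and> bar (TypeC n) l \<in> rights ps"

fun bar_Suc_in :: "cartan_type \<Rightarrow> nat \<Rightarrow> (nat \<times> nat) list \<Rightarrow> bool" where
  "bar_Suc_in (TypeA n) l ps \<longleftrightarrow> False"
| "bar_Suc_in (TypeC n) l ps \<longleftrightarrow> l \<noteq> n \<and> bar (TypeC n) (l + 1) \<in> rights ps"

text \<open>
  The bracketed conditions of the properties: \<open>cond_a\<close> for (a) and (a'), \<open>cond_or\<close> for (b) and
  (d), \<open>cond_c\<close> for (c), \<open>cond_and\<close> for (d'). The pair \<open>(i\<^sub>1, i\<^sub>1')\<close> is \<open>hd ps\<close>.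
\<close>

fun cond_a :: "nat \<Rightarrow> rseq \<Rightarrow> bool" where
  "cond_a l (i, ps) \<longleftrightarrow>
    (if l < i then l + 1 \<in> lefts ps
     else if l > i then l - 1 \<in> rights ps
     else True)"

fun cond_or :: "nat \<Rightarrow> rseq \<Rightarrow> bool" where
  "cond_or l (i, ps) \<longleftrightarrow>
    (if l < i then l + 1 \<notin> lefts ps \<or> l \<in> lefts ps
     else if l > i then l - 1 \<notin> rights ps \<or> l \<in> rights ps
     else ps \<noteq> [] \<and> (l = fst (hd ps) \<or> l = snd (hd ps)))"

fun cond_c :: "nat \<Rightarrow> rseq \<Rightarrow> bool" where
  "cond_c l (i, ps) \<longleftrightarrow>
    (if l < i then l + 1 \<notin> lefts ps
     else if l > i then l - 1 \<notin> rights ps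
     else ps \<noteq> [] \<and> hd ps = (l, l))"

fun cond_and :: "nat \<Rightarrow> rseq \<Rightarrow> bool" where
  "cond_and l (i, ps) \<longleftrightarrow>
    (if l < i then l + 1 \<notin> lefts ps \<and> l \<in> lefts ps
     else if l > i then l - 1 \<notin> rights ps \<and> l \<in> rights ps
     else ps \<noteq> [] \<and> (l = fst (hd ps) \<and> l = snd (hd ps)))"

fun prop_a :: "cartan_type \<Rightarrow> nat \<Rightarrow> rseq \<Rightarrow> bool" where
  "prop_a g l (i, ps) \<longleftrightarrow> l \<notin> lefts ps \<union> rights ps \<and> cond_a l (i, ps) \<and>
     (bar_Suc_in g l ps \<or> \<not> bar_in g l ps)"

fun prop_a' :: "cartan_type \<Rightarrow> nat \<Rightarrow> rseq \<Rightarrow> bool" where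
  "prop_a' g l (i, ps) \<longleftrightarrow> l \<notin> lefts ps \<union> rights ps \<and> cond_a l (i, ps) \<and>
     (bar_Suc_in g l ps \<and> \<not> bar_in g l ps)"

fun prop_b :: "cartan_type \<Rightarrow> nat \<Rightarrow> rseq \<Rightarrow> bool" where
  "prop_b g l (i, ps) \<longleftrightarrow> \<not> bar_in g l ps \<and> bar_Suc_in g l ps \<and> cond_or l (i, ps)"

fun prop_c :: "cartan_type \<Rightarrow> nat \<Rightarrow> rseq \<Rightarrow> bool" where
  "prop_c g l (i, ps) \<longleftrightarrow> l \<in> lefts ps \<union> rights ps \<and> cond_c l (i, ps) \<and>
     (bar_Suc_in g l ps \<or> \<not> bar_in g l ps)"

fun prop_d :: "cartan_type \<Rightarrow> nat \<Rightarrow> rseq \<Rightarrow> bool" where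
  "prop_d g l (i, ps) \<longleftrightarrow> bar_in g l ps \<and> \<not> bar_Suc_in g l ps \<and> cond_or l (i, ps)"

fun prop_d' :: "cartan_type \<Rightarrow> nat \<Rightarrow> rseq \<Rightarrow> bool" where
  "prop_d' g l (i, ps) \<longleftrightarrow> bar_in g l ps \<and> \<not> bar_Suc_in g l ps \<and> cond_and l (i, ps)"

definition replace :: "nat \<Rightarrow> nat \<Rightarrow> nat \<Rightarrow> nat" where
  "replace u v a = (if a = u then v else a)"

definition replace_left :: "nat \<Rightarrow> nat \<Rightarrow> (nat \<times> nat) list \<Rightarrow> (nat \<times> nat) list" where
  "replace_left u v ps = map (\<lambda>(a, a'). (replace u v a, a')) ps"

definition replace_right :: "nat \<Rightarrow> nat \<Rightarrow> (nat \<times> nat) list \<Rightarrow> (nat \<times> nat) list" where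
  "replace_right u v ps = map (\<lambda>(a, a'). (a, replace u v a')) ps"

text \<open>
  (a) and (b) exclude each other, as do (c) and (d), so the order of the case distinctions is
  immaterial. A pair \<open>(i, i)\<close> can only stand at the head of a sequence with superscript \<open>i\<close>.
\<close>

fun theta :: "cartan_type \<Rightarrow> nat \<Rightarrow> rseq \<Rightarrow> rseq option" where
  "theta g l (i, ps) =
    (if prop_a g l (i, ps) then
       Some (i, if l < i then replace_left (l + 1) l ps
                else if l > i then replace_right (l - 1) l ps
                else (l, l) # ps)
     else if prop_b g l (i, ps) then Some (i, replace_right (bar g (l + 1)) (bar g l) ps)
     else None)"

fun rho :: "cartan_type \<Rightarrow> nat \<Rightarrow> rseq \<Rightarrow> rseq option" where
  "rho g l (i, ps) =
    (if prop_c g l (i, ps) then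
       Some (i, if l < i then replace_left l (l + 1) ps
                else if l > i then replace_right l (l - 1) ps
                else remove1 (l, l) ps)
     else if prop_d g l (i, ps) then Some (i, replace_right (bar g l) (bar g (l + 1)) ps)
     else None)"

text \<open>
  \<open>segment_root g a a'\<close> is the root \<open>\<alpha>\<close> indexed by \<open>a\<close> and \<open>a'\<close>: the sum of the simple roots
  from \<open>a\<close> to \<open>a'\<close> if \<open>a' \<le> n\<close>; if \<open>a' = bar j\<close> with \<open>j < n\<close>, the sum from \<open>a\<close> up to \<open>n\<close> and
  back from \<open>n - 1\<close> down to \<open>j\<close>.
\<close>

definition segment_root :: "cartan_type \<Rightarrow> nat \<Rightarrow> nat \<Rightarrow> weight" where
  "segment_root g a a' =
    (let n = lie_rank g in
     if a' \<le> n then (\<Sum>m=a..a'. simple_root g m)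
     else (\<Sum>m=a..n. simple_root g m) + (\<Sum>m=bar g a'..<n. simple_root g m))"

fun rseq_wt :: "cartan_type \<Rightarrow> rseq \<Rightarrow> weight" where
  "rseq_wt g (i, ps) = (\<Sum>(a, a')\<leftarrow>ps. segment_root g a a')"

definition support :: "(nat \<Rightarrow> rseq option) \<Rightarrow> nat set" where
  "support x = {j. x j \<noteq> None}"

definition Rinf_wt :: "cartan_type \<Rightarrow> (nat \<Rightarrow> rseq option) \<Rightarrow> weight" where
  "Rinf_wt g x =
    (\<Sum>i\<in>index_set g. frag_cmul (int (card {j. x j \<in> (\<Union>s. Some ` Rset g i s)})) (fundamental_weight i))
    - (\<Sum>j\<in>support x. rseq_wt g (the (x j)))"

text \<open>
  \<open>num_comps x\<close> is the number \<open>k\<close> of non-zero components, \<open>pos x p\<close> the position of the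
  \<open>p\<close>-th one and \<open>comp_at x p\<close> its value, for \<open>1 \<le> p \<le> k\<close>.
\<close>

definition num_comps :: "(nat \<Rightarrow> rseq option) \<Rightarrow> nat" where
  "num_comps x = card (support x)"

definition pos :: "(nat \<Rightarrow> rseq option) \<Rightarrow> nat \<Rightarrow> nat" where
  "pos x p = sorted_list_of_set (support x) ! (p - 1)"

definition comp_at :: "(nat \<Rightarrow> rseq option) \<Rightarrow> nat \<Rightarrow> rseq" where
  "comp_at x p = the (x (pos x p))"

definition sigma :: "cartan_type \<Rightarrow> nat \<Rightarrow> nat \<Rightarrow> (nat \<Rightarrow> rseq option) \<Rightarrow> int" where
  "sigma g l j x = (if j = 1 then 0 else
     int (card {p \<in> {1..j - 1}. prop_a g l (comp_at x p) \<or> prop_b g l (comp_at x p)})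
     + int (card {p \<in> {1..j - 1}. prop_a' g l (comp_at x p)}))"

definition tau :: "cartan_type \<Rightarrow> nat \<Rightarrow> nat \<Rightarrow> (nat \<Rightarrow> rseq option) \<Rightarrow> int" where
  "tau g l j x = (if j = 1 then 0 else
     int (card {p \<in> {2..j}. prop_c g l (comp_at x p) \<or> prop_d g l (comp_at x p)})
     + int (card {p \<in> {2..j}. prop_d' g l (comp_at x p)}))"

definition mu :: "cartan_type \<Rightarrow> nat \<Rightarrow> (nat \<Rightarrow> rseq option) \<Rightarrow> int" where
  "mu g l x = (MIN j\<in>{1..num_comps x}. sigma g l j x - tau g l j x)"

definition f_index :: "cartan_type \<Rightarrow> nat \<Rightarrow> (nat \<Rightarrow> rseq option) \<Rightarrow> nat" where
  "f_index g l x = Max {p \<in> {1..num_comps x}. sigma g l p x - tau g l p x = mu g l x}"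

definition e_index :: "cartan_type \<Rightarrow> nat \<Rightarrow> (nat \<Rightarrow> rseq option) \<Rightarrow> nat" where
  "e_index g l x = Min {p \<in> {1..num_comps x}. sigma g l p x - tau g l p x = mu g l x}"

definition Rinf_f ::
  "cartan_type \<Rightarrow> nat \<Rightarrow> (nat \<Rightarrow> rseq option) \<Rightarrow> (nat \<Rightarrow> rseq option) option" where
  "Rinf_f g l x =
    (if num_comps x = 0 then None
     else let p = f_index g l x in
       map_option (\<lambda>y. x(pos x p := Some y)) (theta g l (comp_at x p)))"

definition Rinf_e ::
  "cartan_type \<Rightarrow> nat \<Rightarrow> (nat \<Rightarrow> rseq option) \<Rightarrow> (nat \<Rightarrow> rseq option) option" where
  "Rinf_e g l x =
    (if num_comps x = 0 then None
     else let p = e_index g l x in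
       map_option (\<lambda>y. x(pos x p := Some y)) (rho g l (comp_at x p)))"

text \<open>
  The auxiliary sequence below has first component the empty sequence with superscript \<open>1\<close>, second
  component the first non-zero component of \<open>x\<close>, and all others \<open>0\<close>.
\<close>

definition Rinf_eps :: "cartan_type \<Rightarrow> nat \<Rightarrow> (nat \<Rightarrow> rseq option) \<Rightarrow> int extended" where
  "Rinf_eps g l x =
    (if num_comps x = 0 then Fin 0
     else Fin (tau g l 2 ((\<lambda>_. None)(0 := Some (1, []), 1 := Some (comp_at x 1))) - mu g l x))"

definition Rinf_phi :: "cartan_type \<Rightarrow> nat \<Rightarrow> (nat \<Rightarrow> rseq option) \<Rightarrow> int extended" where
  "Rinf_phi g l x =
    (if num_comps x = 0 then Fin 0
     else Fin (sigma g l (num_comps x + 1) x - tau g l (num_comps x) x - mu g l x))"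

end

theory Submission
  imports Defs
begin

text \<open>
  A sequence with superscript \<open>i\<close> is encoded by its column, the set of letters that arises from
  \<open>{1, ..., i}\<close> when \<open>a\<close> is replaced by \<open>a' + 1\<close> for each pair \<open>(a, a')\<close>. The column determines the
  sequence (\<open>letters_inj\<close>). In type \<open>A\<close> all columns with \<open>i\<close> letters occur, and in type \<open>C\<close> the
  condition on the pairs becomes the usual admissibility of columns (\<open>admissible_iff\<close>). The index
  \<open>l\<close> acts by moving a letter from \<open>l\<close> to \<open>l + 1\<close> or, in type \<open>C\<close> with \<open>l < n\<close>, from \<open>bar l\<close> to
  \<open>bar l + 1\<close>, and the properties (a) to (d') are the signature rule for these two places
  (\<open>prop_iff\<close>). Hence \<open>\<theta>\<close> and \<open>\<rho>\<close> preserve the set of sequences, are inverse to each other,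
  and change \<open>\<epsilon>\<close> and \<open>\<phi>\<close> of a single component by one (\<open>theta_Some\<close>, \<open>rho_Some\<close>).
  The coordinates of \<open>\<omega>\<^sub>i - wt(x)\<close> are sums over the letters of the column (\<open>comp_coord_eq\<close>); this
  gives \<open>\<phi> - \<epsilon>\<close> and the change of weight under a move.

  The operators on infinite sequences then follow the tensor product rule. With
  \<open>H(j) = \<Sum>\<^sub>q\<^sub><\<^sub>j \<phi>(x\<^sub>q) - \<Sum>\<^sub>q\<^sub>\<le>\<^sub>j \<epsilon>(x\<^sub>q)\<close>, the operator \<open>f\<close> acts at the rightmost minimum of \<open>H\<close> and
  \<open>e\<close> at the leftmost one, and \<open>\<epsilon> = -min H\<close>. The action at the rightmost minimum lowers \<open>H\<close> there by
  one and to its right by two, so that the same position becomes the leftmost minimum, and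
  conversely. Therefore \<open>e\<close> and \<open>f\<close> are inverse to each other (\<open>Rinf_f_Some\<close>, \<open>Rinf_e_Some\<close>). They
  fail to act exactly if \<open>\<epsilon> = 0\<close>, respectively \<open>\<phi> = 0\<close>, and as these values drop by one in each
  step, the crystal is semiregular.
\<close>

section \<open>Columns of sequences\<close>

text \<open>
  The conditions defining the sequences with superscript \<open>i\<close>, except for the type \<open>C\<close> condition
  that relates the two entries of a pair.
\<close>

definition nested :: "cartan_type \<Rightarrow> nat \<Rightarrow> (nat \<times> nat) list \<Rightarrow> bool" where
  "nested g i ps \<longleftrightarrow> sorted_wrt (>) (map fst ps) \<and> sorted_wrt (<) (map snd ps) \<and>
     (\<forall>(a, a')\<in>set ps. 1 \<le> a \<and> a \<le> i \<and> i \<le> a' \<and> a' \<le> max_index g)"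

text \<open>
  The column of a sequence: start from the full column \<open>1, ..., i\<close>, and for each pair \<open>(a, a')\<close>
  replace the letter \<open>a\<close> by \<open>a' + 1\<close>. The letters are \<open>1 < ... < n + 1\<close> in type \<open>A\<close> and
  \<open>1 < ... < 2n\<close> in type \<open>C\<close>.
\<close>

definition letters :: "rseq \<Rightarrow> nat set" where
  "letters x = ({1..fst x} - lefts (snd x)) \<union> Suc ` rights (snd x)"

text \<open>
  In type \<open>C\<close> and for \<open>l < n\<close>, the index \<open>l\<close> acts at two places of the alphabet: on the letters
  \<open>l, l + 1\<close> and on the letters \<open>bar l, bar l + 1\<close>. In the other cases, only the first pair exists.
\<close>

definition has_bar :: "cartan_type \<Rightarrow> nat \<Rightarrow> bool" where
  "has_bar g l \<longleftrightarrow> (\<exists>n. g = TypeC n \<and> l \<noteq> n)"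

lemma Rset_iff:
  "(i, ps) \<in> Rset g i' s \<longleftrightarrow> i = i' \<and> length ps = s \<and> nested g i ps \<and>
     (\<forall>n. g = TypeC n \<longrightarrow> (\<forall>(a, a')\<in>set ps. a' \<le> bar g a))"
  by (auto simp: Rset_def nested_def)

lemma nested_lefts: "nested g i ps \<Longrightarrow> a \<in> lefts ps \<Longrightarrow> 1 \<le> a \<and> a \<le> i"
  by (auto simp: nested_def)

lemma nested_rights: "nested g i ps \<Longrightarrow> a \<in> rights ps \<Longrightarrow> i \<le> a \<and> a \<le> max_index g"
  by (auto simp: nested_def)

text \<open>
  The pairs of a nested sequence form a chain of nested intervals, so the order of the first
  entries is opposite to that of the second ones.
\<close>

lemma nested_compare:
  assumes "nested g i ps" "p \<in> set ps" "q \<in> set ps"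
  shows "fst p < fst q \<longleftrightarrow> snd q < snd p"
proof -
  obtain m n where mn: "m < length ps" "p = ps ! m" "n < length ps" "q = ps ! n"
    using assms(2,3) by (auto simp: in_set_conv_nth)
  have s: "sorted_wrt (>) (map fst ps)" "sorted_wrt (<) (map snd ps)"
    using assms(1) by (auto simp: nested_def)
  have "m < n \<Longrightarrow> ?thesis" "n < m \<Longrightarrow> ?thesis" "m = n \<Longrightarrow> ?thesis"
    using mn sorted_wrt_nth_less[OF s(1), of m n] sorted_wrt_nth_less[OF s(2), of m n]
      sorted_wrt_nth_less[OF s(1), of n m] sorted_wrt_nth_less[OF s(2), of n m] by auto
  then show ?thesis by linarith
qed

lemma nested_inj:
  assumes "nested g i ps"
  shows "inj_on fst (set ps)" "inj_on snd (set ps)"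
proof -
  have "distinct (map fst ps)" "distinct (map snd ps)"
    using assms strict_sorted_iff[of "rev (map fst ps)"] strict_sorted_iff[of "map snd ps"]
    by (auto simp: nested_def sorted_wrt_rev)
  then show "inj_on fst (set ps)" "inj_on snd (set ps)" by (auto simp: distinct_map)
qed

text \<open>
  The letters up to \<open>i\<close> record the left entries and those above \<open>i\<close> the right entries; hence
  the column determines the sequence.
\<close>

lemma mem_letters_left:
  assumes "nested g i ps" "1 \<le> j" "j \<le> i"
  shows "j \<in> letters (i, ps) \<longleftrightarrow> j \<notin> lefts ps"
  using assms nested_rights[OF assms(1)] by (force simp: letters_def)

lemma mem_letters_right:
  assumes "nested g i ps" "i \<le> j"
  shows "Suc j \<in> letters (i, ps) \<longleftrightarrow> j \<in> rights ps"
  using assms by (auto simp: letters_def image_iff)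

lemma letters_bounds:
  assumes "nested g i ps" "i \<in> index_set g" "j \<in> letters (i, ps)"
  shows "1 \<le> j \<and> j \<le> Suc (max_index g)"
  using assms nested_rights[OF assms(1)]
  by (cases g) (fastforce simp: letters_def index_set_def)+

lemma letters_inj:
  assumes "nested g i ps" "nested g i qs" "letters (i, ps) = letters (i, qs)"
  shows "ps = qs"
proof -
  have "lefts rs = {1..i} - letters (i, rs)" "rights rs = {a. i \<le> a \<and> Suc a \<in> letters (i, rs)}"
    if rs: "nested g i rs" for rs
  proof -
    show "lefts rs = {1..i} - letters (i, rs)"
      using mem_letters_left[OF rs] nested_lefts[OF rs] by (intro set_eqI iffI) (simp_all, blast+)
    show "rights rs = {a. i \<le> a \<and> Suc a \<in> letters (i, rs)}"
      using mem_letters_right[OF rs] nested_rights[OF rs] by (intro set_eqI iffI) (simp_all, blast+)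
  qed
  from this[OF assms(1)] this[OF assms(2)]
  have "lefts ps = lefts qs" "rights ps = rights qs" by (simp_all only: assms(3))
  then have "rev (map fst ps) = rev (map fst qs)"
    using assms(1,2) \<open>lefts ps = lefts qs\<close>
    by (intro strict_sorted_equal) (auto simp: nested_def sorted_wrt_rev)
  moreover have "map snd ps = map snd qs"
    using assms(1,2) \<open>rights ps = rights qs\<close>
    by (intro strict_sorted_equal) (auto simp: nested_def)
  ultimately show ?thesis by (metis rev_rev_ident zip_map_fst_snd)
qed

text \<open>
  The first \<open>m\<close> and the last \<open>m\<close> of the letters \<open>1, ..., 2n\<close>, together with the
  numbers outside this range, which no column contains.
\<close>

definition zone :: "nat \<Rightarrow> nat \<Rightarrow> nat set" where
  "zone n m = {..m} \<union> {Suc (2 * n) - m..}"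

text \<open>
  The admissibility of a column of type \<open>C\<close>: at most \<open>m\<close> letters lie among the first \<open>m\<close> and the
  last \<open>m\<close> of the alphabet. In type \<open>A\<close> there is no condition.
\<close>

definition admissible :: "cartan_type \<Rightarrow> nat set \<Rightarrow> bool" where
  "admissible g J \<longleftrightarrow> (\<forall>n. g = TypeC n \<longrightarrow> (\<forall>m\<le>n. card (J \<inter> zone n m) \<le> m))"

lemma finite_letters: "finite (letters x)"
  by (simp add: letters_def)

lemma card_letters_zone:
  assumes "nested g i ps" "m \<le> i" "i \<le> n"
  shows "card (letters (i, ps) \<inter> zone n m) + card {p \<in> set ps. fst p \<le> m} =
    m + card {p \<in> set ps. 2 * n - m \<le> snd p}"
proof -
  let ?L = "{p \<in> set ps. fst p \<le> m}" and ?R = "{p \<in> set ps. 2 * n - m \<le> snd p}"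
  have "letters (i, ps) \<inter> zone n m = ({1..m} - fst ` ?L) \<union> Suc ` snd ` ?R"
    using assms nested_rights[OF assms(1)]
    by (force simp: letters_def zone_def image_iff)
  moreover have "({1..m} - fst ` ?L) \<inter> Suc ` snd ` ?R = {}"
    using assms by auto
  moreover have "card (fst ` ?L) = card ?L" "card (snd ` ?R) = card ?R"
    using nested_inj[OF assms(1)] by (auto intro!: card_image intro: inj_on_subset)
  moreover have sub: "fst ` ?L \<subseteq> {1..m}"
    using assms(1) by (auto simp: nested_def)
  then have "card ({1..m} - fst ` ?L) + card (fst ` ?L) = m"
    using card_Diff_subset[of "fst ` ?L" "{1..m}"] card_mono[OF _ sub] by simp
  ultimately show ?thesis
    by (simp add: card_Un_disjoint card_image)
qed

lemma card_letters_le: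
  assumes "nested g i ps"
  shows "card (letters (i, ps)) \<le> i"
proof -
  have sub: "lefts ps \<subseteq> {1..i}" using assms by (auto simp: nested_def)
  have c: "card (lefts ps) = card (rights ps)"
    using nested_inj[OF assms] by (simp add: card_image)
  have "card (letters (i, ps)) \<le> card ({1..i} - lefts ps) + card (Suc ` rights ps)"
    unfolding letters_def by (simp add: card_Un_le)
  also have "\<dots> = i - card (lefts ps) + card (lefts ps)"
    using card_Diff_subset[OF _ sub] by (simp add: c card_image)
  also have "\<dots> = i" using card_mono[OF _ sub] by simp
  finally show ?thesis .
qed

text \<open>
  For \<open>m \<ge> i\<close> the bound holds because a column has at most \<open>i\<close> letters. For \<open>m \<le> i\<close>, by counting
  the letters of a zone in terms of pairs, it says that at least as many pairs have \<open>a \<le> m\<close> as have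
  \<open>a' \<ge> 2n - m\<close>. Since the pairs are nested, this is equivalent to
  \<open>a' \<le> bar a\<close> for each pair.
\<close>

lemma admissible_iff:
  assumes ne: "nested g i ps" and i: "i \<in> index_set g"
  shows "(\<forall>n. g = TypeC n \<longrightarrow> (\<forall>(a, a')\<in>set ps. a' \<le> bar g a)) \<longleftrightarrow> admissible g (letters (i, ps))"
proof (cases g)
  case (TypeA n)
  then show ?thesis by (simp add: admissible_def)
next
  case (TypeC n)
  have i': "i \<le> n" using i TypeC by (simp add: index_set_def)
  have "(\<forall>(a, a')\<in>set ps. a' \<le> bar g a) \<longleftrightarrow> (\<forall>m\<le>n. card (letters (i, ps) \<inter> zone n m) \<le> m)"
  proof
    assume *: "\<forall>(a, a')\<in>set ps. a' \<le> bar g a"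
    show "\<forall>m\<le>n. card (letters (i, ps) \<inter> zone n m) \<le> m"
    proof (intro allI impI)
      fix m assume "m \<le> n"
      show "card (letters (i, ps) \<inter> zone n m) \<le> m"
      proof (cases "m \<le> i")
        case True
        have "{p \<in> set ps. 2 * n - m \<le> snd p} \<subseteq> {p \<in> set ps. fst p \<le> m}"
          using * TypeC nested_lefts[OF ne] i' True by fastforce
        then have "card {p \<in> set ps. 2 * n - m \<le> snd p} \<le> card {p \<in> set ps. fst p \<le> m}"
          by (intro card_mono) auto
        then show ?thesis using card_letters_zone[OF ne True i'] by linarith
      next
        case False
        have "card (letters (i, ps) \<inter> zone n m) \<le> card (letters (i, ps))"
          by (intro card_mono finite_letters) auto
        then show ?thesis using card_letters_le[OF ne] False by linarith
      qed
    qed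
  next
    assume *: "\<forall>m\<le>n. card (letters (i, ps) \<inter> zone n m) \<le> m"
    show "\<forall>(a, a')\<in>set ps. a' \<le> bar g a"
    proof (clarify, rule ccontr)
      fix a a' assume p: "(a, a') \<in> set ps" and "\<not> a' \<le> bar g a"
      then have a': "2 * n - a < a'" using TypeC by simp
      have a: "1 \<le> a" "a \<le> i" using p nested_lefts[OF ne, of a] by force+
      \<comment> \<open>A violating pair \<open>(a, a')\<close> breaks the count for \<open>m = a - 1\<close>.\<close>
      let ?L = "{p \<in> set ps. fst p \<le> a - 1}" and ?R = "{p \<in> set ps. 2 * n - (a - 1) \<le> snd p}"
      have "?L \<subseteq> ?R"
      proof clarsimp
        fix b b' assume "(b, b') \<in> set ps" "b \<le> a - Suc 0"
        then have "a' < b'"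
          using nested_compare[OF ne, of "(b, b')" "(a, a')"] p a by auto
        then show "2 * n - (a - Suc 0) \<le> b'" using a' by linarith
      qed
      moreover have "(a, a') \<in> ?R - ?L" using p a a' by auto
      ultimately have "?L \<subset> ?R" by blast
      then have "card ?L < card ?R" by (intro psubset_card_mono) auto
      moreover have "card (letters (i, ps) \<inter> zone n (a - 1)) \<le> a - 1"
        using * a i' by simp
      ultimately show False
        using card_letters_zone[OF ne, of "a - 1" n] a i' by linarith
    qed
  qed
  then show ?thesis using TypeC by (simp add: admissible_def)
qed

lemma Rset_iff_admissible:
  assumes "i \<in> index_set g"
  shows "(i, ps) \<in> Rset g i s \<longleftrightarrow> length ps = s \<and> nested g i ps \<and> admissible g (letters (i, ps))"
proof (cases "nested g i ps")
  case True
  then show ?thesis unfolding Rset_iff admissible_iff[OF True assms] by simp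
qed (simp add: Rset_iff)

lemma int_card_move:
  assumes "finite J" "p \<in> J" "q \<notin> J"
  shows "int (card (insert q (J - {p}) \<inter> Z)) = int (card (J \<inter> Z)) - of_bool (p \<in> Z) + of_bool (q \<in> Z)"
proof -
  have "card (J \<inter> Z) = card ((J - {p}) \<inter> Z) + of_bool (p \<in> Z)"
  proof (cases "p \<in> Z")
    case True
    then have "J \<inter> Z = insert p ((J - {p}) \<inter> Z)" using assms by auto
    then show ?thesis using True assms(1) by simp
  next
    case False
    then have "J \<inter> Z = (J - {p}) \<inter> Z" by auto
    then show ?thesis using False by simp
  qed
  moreover have "card (insert q (J - {p}) \<inter> Z) = card ((J - {p}) \<inter> Z) + of_bool (q \<in> Z)"
    using assms by (cases "q \<in> Z") (auto simp: Int_insert_left)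
  ultimately show ?thesis by simp
qed

text \<open>
  The two cases in which the zone of size \<open>l\<close> can take one more letter: either it has no letter
  outside the zone of size \<open>l - 1\<close>, or the zone of size \<open>l + 1\<close> has two letters outside it.
\<close>

lemma admissible_room:
  assumes adm: "admissible (TypeC n) J" and fin: "finite J" and J: "J \<subseteq> {1..2 * n}"
    and l: "1 \<le> l" "l < n"
    and bits: "(l \<notin> J \<and> Suc (2 * n - l) \<notin> J) \<or> (Suc l \<in> J \<and> 2 * n - l \<in> J)"
  shows "card (J \<inter> zone n l) < l"
  using bits
proof
  assume *: "l \<notin> J \<and> Suc (2 * n - l) \<notin> J"
  have "x \<in> zone n (l - 1)" if "x \<in> J" "x \<in> zone n l" for x
    using that * l by (cases "x = l"; cases "x = Suc (2 * n - l)") (auto simp: zone_def)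
  then have "J \<inter> zone n l = J \<inter> zone n (l - 1)" using l by (auto simp: zone_def)
  moreover have "card (J \<inter> zone n (l - 1)) \<le> l - 1"
    using adm l by (simp add: admissible_def)
  ultimately show ?thesis using l by simp
next
  assume *: "Suc l \<in> J \<and> 2 * n - l \<in> J"
  have "insert (Suc l) (insert (2 * n - l) (J \<inter> zone n l)) \<subseteq> J \<inter> zone n (Suc l)"
    using * l by (auto simp: zone_def)
  then have "card (insert (Suc l) (insert (2 * n - l) (J \<inter> zone n l))) \<le> card (J \<inter> zone n (Suc l))"
    using fin by (intro card_mono) auto
  moreover have "card (J \<inter> zone n (Suc l)) \<le> Suc l"
    using adm l by (simp add: admissible_def)
  moreover have "card (insert (Suc l) (insert (2 * n - l) (J \<inter> zone n l))) = card (J \<inter> zone n l) + 2"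
    using fin l by (auto simp: zone_def card_insert_if)
  ultimately show ?thesis by simp
qed

text \<open>
  Replacing the letter \<open>p\<close> by \<open>q\<close> can only increase the count of a zone that contains \<open>q\<close> and
  not \<open>p\<close>.
\<close>

lemma admissible_move:
  assumes adm: "admissible g J" and fin: "finite J" and pq: "p \<in> J" "q \<notin> J"
    and move: "\<And>n m. g = TypeC n \<Longrightarrow> m \<le> n \<Longrightarrow>
      (q \<in> zone n m \<longrightarrow> p \<in> zone n m) \<or> card (J \<inter> zone n m) < m"
  shows "admissible g (insert q (J - {p}))"
  unfolding admissible_def
proof (intro allI impI)
  fix n m assume g: "g = TypeC n" and m: "m \<le> n"
  have "card (J \<inter> zone n m) \<le> m" using adm g m by (simp add: admissible_def)
  then show "card (insert q (J - {p}) \<inter> zone n m) \<le> m"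
    using move[OF g m] int_card_move[OF fin pq, of "zone n m"] by (auto split: if_splits simp: of_bool_def)
qed

text \<open>
  All non-zero values of a component, over all superscripts \<open>i \<in> I\<close> and all lengths.
\<close>

definition components :: "cartan_type \<Rightarrow> rseq set" where
  "components g = (\<Union>i\<in>index_set g. \<Union>s. Rset g i s)"

section \<open>Action on columns\<close>

lemma map_replace_left:
  "map fst (replace_left u v ps) = map (replace u v) (map fst ps)"
  "map snd (replace_left u v ps) = map snd ps"
  by (auto simp: replace_left_def)

lemma map_replace_right:
  "map fst (replace_right u v ps) = map fst ps"
  "map snd (replace_right u v ps) = map (replace u v) (map snd ps)"
  by (auto simp: replace_right_def)

lemma lefts_replace_left:
  "lefts (replace_left u v ps) = replace u v ` lefts ps" "rights (replace_left u v ps) = rights ps"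
  by (simp_all add: replace_left_def image_image split_beta)

lemma rights_replace_right:
  "lefts (replace_right u v ps) = lefts ps" "rights (replace_right u v ps) = replace u v ` rights ps"
  by (simp_all add: replace_right_def image_image split_beta)

lemma replace_image:
  assumes "u \<in> A" "v \<notin> A"
  shows "replace u v ` A = insert v (A - {u})"
  using assms by (auto simp: replace_def)

lemma nested_iff:
  "nested g i ps \<longleftrightarrow> sorted_wrt (>) (map fst ps) \<and> sorted_wrt (<) (map snd ps) \<and>
     (\<forall>a\<in>lefts ps. 1 \<le> a \<and> a \<le> i) \<and> (\<forall>a\<in>rights ps. i \<le> a \<and> a \<le> max_index g)"
  by (auto simp: nested_def)

text \<open>
  Moving an entry to a neighbouring free value keeps the order of the entries, and moves one
  letter of the column in the opposite direction for left entries and in the same direction for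
  right entries.
\<close>

lemma replace_left_nested:
  assumes ne: "nested g i ps" and u: "u \<in> lefts ps" and v: "v \<notin> lefts ps" "1 \<le> v" "v \<le> i"
    and uv: "u = Suc v \<or> v = Suc u"
  shows "nested g i (replace_left u v ps)"
    and "letters (i, replace_left u v ps) = insert u (letters (i, ps) - {v})"
proof -
  have l: "lefts (replace_left u v ps) = insert v (lefts ps - {u})"
    unfolding lefts_replace_left using replace_image[OF u v(1)] .
  have r: "rights (replace_left u v ps) = rights ps"
    by (rule lefts_replace_left)
  have "sorted_wrt (\<lambda>a b. replace u v b < replace u v a) (map fst ps)"
  proof (rule sorted_wrt_mono_rel[where P = "(>)"])
    show "sorted_wrt (>) (map fst ps)" using ne by (simp add: nested_iff)
  next
    fix a b assume ab: "a \<in> set (map fst ps)" "b \<in> set (map fst ps)" "a > b"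
    then have "a \<noteq> v" "b \<noteq> v" using v(1) by auto
    then show "replace u v b < replace u v a" using ab(3) uv by (auto simp: replace_def)
  qed
  then show "nested g i (replace_left u v ps)"
    using ne v unfolding nested_iff l r map_replace_left sorted_wrt_map by auto
  have "v \<notin> Suc ` rights ps" "1 \<le> u" "u \<le> i"
    using nested_rights[OF ne] nested_lefts[OF ne u] v by force+
  then show "letters (i, replace_left u v ps) = insert u (letters (i, ps) - {v})"
    using u v uv unfolding letters_def snd_conv fst_conv l r by auto
qed

lemma replace_right_nested:
  assumes ne: "nested g i ps" and u: "u \<in> rights ps" and v: "v \<notin> rights ps" "i \<le> v" "v \<le> max_index g"
    and uv: "u = Suc v \<or> v = Suc u"
  shows "nested g i (replace_right u v ps)"
    and "letters (i, replace_right u v ps) = insert (Suc v) (letters (i, ps) - {Suc u})"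
proof -
  have r: "rights (replace_right u v ps) = insert v (rights ps - {u})"
    unfolding rights_replace_right using replace_image[OF u v(1)] .
  have l: "lefts (replace_right u v ps) = lefts ps"
    by (rule rights_replace_right)
  have "sorted_wrt (\<lambda>a b. replace u v a < replace u v b) (map snd ps)"
  proof (rule sorted_wrt_mono_rel[where P = "(<)"])
    show "sorted_wrt (<) (map snd ps)" using ne by (simp add: nested_iff)
  next
    fix a b assume ab: "a \<in> set (map snd ps)" "b \<in> set (map snd ps)" "a < b"
    then have "a \<noteq> v" "b \<noteq> v" using v(1) by auto
    then show "replace u v a < replace u v b" using ab(3) uv by (auto simp: replace_def)
  qed
  then show "nested g i (replace_right u v ps)"
    using ne v unfolding nested_iff l r map_replace_right sorted_wrt_map by auto
  have "i \<le> u" using nested_rights[OF ne u] by simp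
  then show "letters (i, replace_right u v ps) = insert (Suc v) (letters (i, ps) - {Suc u})"
    using u v uv unfolding letters_def snd_conv fst_conv l r by auto
qed

lemma Cons_nested:
  assumes ne: "nested g i ps" and i: "1 \<le> i" "i \<le> max_index g" "i \<notin> lefts ps" "i \<notin> rights ps"
  shows "nested g i ((i, i) # ps)"
    and "letters (i, (i, i) # ps) = insert (Suc i) (letters (i, ps) - {i})"
proof -
  show "nested g i ((i, i) # ps)"
    using ne i by (fastforce simp: nested_iff le_less)
  show "letters (i, (i, i) # ps) = insert (Suc i) (letters (i, ps) - {i})"
    using nested_rights[OF ne] by (fastforce simp: letters_def)
qed

lemma tl_nested:
  assumes ne: "nested g i ((i, i) # qs)"
  shows "nested g i qs"
    and "letters (i, qs) = insert i (letters (i, (i, i) # qs) - {Suc i})"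
proof -
  show n: "nested g i qs" using ne by (auto simp: nested_def)
  have i: "1 \<le> i" "i \<le> max_index g" "i \<notin> lefts qs" "i \<notin> rights qs"
    using ne by (force simp: nested_def)+
  have "i \<in> letters (i, qs)" "Suc i \<notin> letters (i, qs)"
    using mem_letters_left[OF n i(1)] mem_letters_right[OF n order_refl] i by auto
  then show "letters (i, qs) = insert i (letters (i, (i, i) # qs) - {Suc i})"
    unfolding Cons_nested(2)[OF n i] by auto
qed

text \<open>
  Only the first pair of a sequence with superscript \<open>i\<close> can contain \<open>i\<close>.
\<close>

lemma hd_nested:
  assumes "nested g i ps"
  shows "ps \<noteq> [] \<and> i = fst (hd ps) \<longleftrightarrow> i \<in> lefts ps"
    and "ps \<noteq> [] \<and> i = snd (hd ps) \<longleftrightarrow> i \<in> rights ps"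
  using assms by (cases ps; force simp: nested_def)+

text \<open>
  The letter \<open>p\<close> of the column \<open>J\<close> can be replaced by \<open>p + 1\<close>, respectively \<open>p + 1\<close> by \<open>p\<close>.
\<close>

definition raisable :: "nat \<Rightarrow> nat set \<Rightarrow> bool" where
  "raisable p J \<longleftrightarrow> p \<in> J \<and> Suc p \<notin> J"

definition lowerable :: "nat \<Rightarrow> nat set \<Rightarrow> bool" where
  "lowerable p J \<longleftrightarrow> p \<notin> J \<and> Suc p \<in> J"

lemma index_set_bounds: "j \<in> index_set g \<Longrightarrow> 1 \<le> j \<and> j \<le> max_index g"
  by (cases g) (auto simp: index_set_def)

context
  fixes g :: cartan_type and i l :: nat and ps :: "(nat \<times> nat) list"
  assumes ne: "nested g i ps" and i: "i \<in> index_set g" and l: "l \<in> index_set g"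
begin

lemma index_bounds:
  "1 \<le> i" "i \<le> max_index g" "1 \<le> l" "l \<le> max_index g"
  using index_set_bounds i l by blast+

text \<open>
  The letters \<open>l\<close> and \<open>l + 1\<close> in terms of the entries, according to the position of \<open>l\<close> relative
  to the superscript.
\<close>

lemma letters_bits:
  "l < i \<Longrightarrow> (l \<in> letters (i, ps) \<longleftrightarrow> l \<notin> lefts ps) \<and>
     (Suc l \<in> letters (i, ps) \<longleftrightarrow> Suc l \<notin> lefts ps) \<and> l \<notin> rights ps"
  "l = i \<Longrightarrow> (l \<in> letters (i, ps) \<longleftrightarrow> l \<notin> lefts ps) \<and>
     (Suc l \<in> letters (i, ps) \<longleftrightarrow> l \<in> rights ps)"
  "i < l \<Longrightarrow> (l \<in> letters (i, ps) \<longleftrightarrow> l - 1 \<in> rights ps) \<and>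
     (Suc l \<in> letters (i, ps) \<longleftrightarrow> l \<in> rights ps) \<and> l \<notin> lefts ps"
  using mem_letters_left[OF ne, of l] mem_letters_left[OF ne, of "Suc l"]
    mem_letters_right[OF ne, of l] mem_letters_right[OF ne, of "l - 1"]
    nested_lefts[OF ne, of l] nested_rights[OF ne, of l] index_bounds by auto

text \<open>
  In terms of the column, the conditions on \<open>l\<close> no longer depend on whether \<open>l\<close> is below, equal to
  or above the superscript.
\<close>

lemma cond_iff:
  "l \<notin> lefts ps \<union> rights ps \<and> cond_a l (i, ps) \<longleftrightarrow> raisable l (letters (i, ps))"
  "l \<in> lefts ps \<union> rights ps \<and> cond_c l (i, ps) \<longleftrightarrow> lowerable l (letters (i, ps))"
  "cond_or l (i, ps) \<longleftrightarrow> \<not> raisable l (letters (i, ps))"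
  "cond_and l (i, ps) \<longleftrightarrow> lowerable l (letters (i, ps))"
proof -
  have hd: "ps \<noteq> [] \<and> hd ps = (i, i) \<longleftrightarrow> i \<in> lefts ps \<and> i \<in> rights ps"
    using hd_nested[OF ne] by (metis prod.collapse fst_conv snd_conv)
  consider "l < i" | "l = i" | "i < l" by linarith
  note split = this
  show "l \<notin> lefts ps \<union> rights ps \<and> cond_a l (i, ps) \<longleftrightarrow> raisable l (letters (i, ps))"
    using split letters_bits by cases (auto simp: raisable_def)
  show "l \<in> lefts ps \<union> rights ps \<and> cond_c l (i, ps) \<longleftrightarrow> lowerable l (letters (i, ps))"
    using split
  proof cases
    case 2
    then show ?thesis using letters_bits(2) hd by (simp add: lowerable_def) blast
  qed (use letters_bits in \<open>auto simp: lowerable_def\<close>)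
  show "cond_or l (i, ps) \<longleftrightarrow> \<not> raisable l (letters (i, ps))"
    using split
  proof cases
    case 2
    then show ?thesis using letters_bits(2) hd_nested[OF ne] by (simp add: raisable_def) blast
  qed (use letters_bits in \<open>auto simp: raisable_def\<close>)
  show "cond_and l (i, ps) \<longleftrightarrow> lowerable l (letters (i, ps))"
    using split
  proof cases
    case 2
    then show ?thesis using letters_bits(2) hd_nested[OF ne] by (simp add: lowerable_def) blast
  qed (use letters_bits in \<open>auto simp: lowerable_def\<close>)
qed

lemma bar_bounds:
  assumes "has_bar g l"
  shows "bar g l = Suc (bar g (l + 1))" "i \<le> bar g (l + 1)" "bar g l \<le> max_index g" "Suc l < bar g l"
  using assms i l by (auto simp: has_bar_def index_set_def)

lemma bar_in_iff:
  "bar_in g l ps \<longleftrightarrow> has_bar g l \<and> Suc (bar g l) \<in> letters (i, ps)"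
  "bar_Suc_in g l ps \<longleftrightarrow> has_bar g l \<and> bar g l \<in> letters (i, ps)"
proof -
  have "bar_in g l ps \<longleftrightarrow> has_bar g l \<and> bar g l \<in> rights ps"
    "bar_Suc_in g l ps \<longleftrightarrow> has_bar g l \<and> bar g (l + 1) \<in> rights ps"
    by (cases g; simp add: has_bar_def)+
  then show "bar_in g l ps \<longleftrightarrow> has_bar g l \<and> Suc (bar g l) \<in> letters (i, ps)"
    "bar_Suc_in g l ps \<longleftrightarrow> has_bar g l \<and> bar g l \<in> letters (i, ps)"
    using mem_letters_right[OF ne, of "bar g l"] mem_letters_right[OF ne, of "bar g (l + 1)"] bar_bounds
    by (cases "has_bar g l"; simp)+
qed

text \<open>
  The properties form the signature rule for the two places \<open>l\<close> and \<open>bar l\<close> at which the index \<open>l\<close>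
  acts: \<open>\<theta>\<close> raises at \<open>l\<close> if possible, unless \<open>bar l\<close> can be lowered, and otherwise raises at
  \<open>bar l\<close> if possible; similarly \<open>\<rho>\<close> lowers at \<open>bar l\<close> if possible, unless \<open>l\<close> can be raised, and
  otherwise lowers at \<open>l\<close> if possible.
\<close>

lemma prop_iff:
  "prop_a g l (i, ps) \<longleftrightarrow> raisable l (letters (i, ps)) \<and> \<not> (has_bar g l \<and> lowerable (bar g l) (letters (i, ps)))"
  "prop_a' g l (i, ps) \<longleftrightarrow> raisable l (letters (i, ps)) \<and> has_bar g l \<and> raisable (bar g l) (letters (i, ps))"
  "prop_b g l (i, ps) \<longleftrightarrow> \<not> raisable l (letters (i, ps)) \<and> has_bar g l \<and> raisable (bar g l) (letters (i, ps))"
  "prop_c g l (i, ps) \<longleftrightarrow> lowerable l (letters (i, ps)) \<and> \<not> (has_bar g l \<and> lowerable (bar g l) (letters (i, ps)))"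
  "prop_d g l (i, ps) \<longleftrightarrow> \<not> raisable l (letters (i, ps)) \<and> has_bar g l \<and> lowerable (bar g l) (letters (i, ps))"
  "prop_d' g l (i, ps) \<longleftrightarrow> lowerable l (letters (i, ps)) \<and> has_bar g l \<and> lowerable (bar g l) (letters (i, ps))"
proof -
  let ?J = "letters (i, ps)" and ?B = "bar_in g l ps" and ?S = "bar_Suc_in g l ps"
  have r: "?S \<and> \<not> ?B \<longleftrightarrow> has_bar g l \<and> raisable (bar g l) ?J"
    and lo: "?S \<or> \<not> ?B \<longleftrightarrow> \<not> (has_bar g l \<and> lowerable (bar g l) ?J)"
    unfolding bar_in_iff raisable_def lowerable_def by blast+
  show "prop_a g l (i, ps) \<longleftrightarrow> raisable l ?J \<and> \<not> (has_bar g l \<and> lowerable (bar g l) ?J)"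
    unfolding prop_a.simps cond_iff(1)[symmetric] lo[symmetric] by blast
  show "prop_a' g l (i, ps) \<longleftrightarrow> raisable l ?J \<and> has_bar g l \<and> raisable (bar g l) ?J"
    unfolding prop_a'.simps cond_iff(1)[symmetric] r[symmetric] by blast
  show "prop_b g l (i, ps) \<longleftrightarrow> \<not> raisable l ?J \<and> has_bar g l \<and> raisable (bar g l) ?J"
    unfolding prop_b.simps cond_iff(3) r[symmetric] by blast
  show "prop_c g l (i, ps) \<longleftrightarrow> lowerable l ?J \<and> \<not> (has_bar g l \<and> lowerable (bar g l) ?J)"
    unfolding prop_c.simps cond_iff(2)[symmetric] lo[symmetric] by blast
  show "prop_d g l (i, ps) \<longleftrightarrow> \<not> raisable l ?J \<and> has_bar g l \<and> lowerable (bar g l) ?J"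
    unfolding prop_d.simps cond_iff(3) using lo by blast
  show "prop_d' g l (i, ps) \<longleftrightarrow> lowerable l ?J \<and> has_bar g l \<and> lowerable (bar g l) ?J"
    unfolding prop_d'.simps cond_iff(4) using lo by blast
qed

text \<open>
  The next four lemmas compute the column after \<open>\<theta>\<close> or \<open>\<rho>\<close> has acted at the first place
  \<open>l\<close> or at the second place \<open>bar l\<close>.
\<close>

lemma theta_first:
  assumes r: "raisable l (letters (i, ps))"
    and "\<not> (has_bar g l \<and> lowerable (bar g l) (letters (i, ps)))"
  obtains qs where "theta g l (i, ps) = Some (i, qs)" "nested g i qs"
    "letters (i, qs) = insert (Suc l) (letters (i, ps) - {l})"
proof -
  have a: "prop_a g l (i, ps)" using assms prop_iff(1) by blast
  consider "l < i" | "l = i" | "i < l" by linarith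
  then show ?thesis
  proof cases
    case 1
    then have "Suc l \<in> lefts ps" "l \<notin> lefts ps"
      using r letters_bits(1) by (auto simp: raisable_def)
    then show ?thesis
      using that[of "replace_left (Suc l) l ps"] a 1 replace_left_nested[OF ne, of "Suc l" l] index_bounds by simp
  next
    case 2
    then have "i \<notin> lefts ps" "i \<notin> rights ps"
      using r letters_bits(2) by (auto simp: raisable_def)
    then show ?thesis
      using that[of "(l, l) # ps"] a 2 Cons_nested[OF ne] index_bounds by simp
  next
    case 3
    then have "l - 1 \<in> rights ps" "l \<notin> rights ps"
      using r letters_bits(3) by (auto simp: raisable_def)
    then show ?thesis
      using that[of "replace_right (l - 1) l ps"] a 3 replace_right_nested[OF ne, of "l - 1" l] index_bounds by simp
  qed
qed

lemma rho_first:
  assumes r: "lowerable l (letters (i, ps))"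
    and "\<not> (has_bar g l \<and> lowerable (bar g l) (letters (i, ps)))"
  obtains qs where "rho g l (i, ps) = Some (i, qs)" "nested g i qs"
    "letters (i, qs) = insert l (letters (i, ps) - {Suc l})"
proof -
  have c: "prop_c g l (i, ps)" using assms prop_iff(4) by blast
  consider "l < i" | "l = i" | "i < l" by linarith
  then show ?thesis
  proof cases
    case 1
    then have "l \<in> lefts ps" "Suc l \<notin> lefts ps"
      using r letters_bits(1) by (auto simp: lowerable_def)
    then show ?thesis
      using that[of "replace_left l (Suc l) ps"] c 1 replace_left_nested[OF ne, of l "Suc l"] index_bounds by simp
  next
    case 2
    then have "i \<in> lefts ps" "i \<in> rights ps"
      using r letters_bits(2) by (auto simp: lowerable_def)
    then obtain qs where qs: "ps = (i, i) # qs"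
      using hd_nested[OF ne] by (metis list.exhaust_sel prod.collapse)
    then show ?thesis
      using that[of qs] c 2 tl_nested[of g i qs] ne by simp
  next
    case 3
    then have "l - 1 \<notin> rights ps" "l \<in> rights ps"
      using r letters_bits(3) by (auto simp: lowerable_def)
    then show ?thesis
      using that[of "replace_right l (l - 1) ps"] c 3 replace_right_nested[OF ne, of l "l - 1"] index_bounds by simp
  qed
qed

lemma theta_second:
  assumes h: "has_bar g l" and r: "raisable (bar g l) (letters (i, ps))"
    and "\<not> raisable l (letters (i, ps))"
  obtains qs where "theta g l (i, ps) = Some (i, qs)" "nested g i qs"
    "letters (i, qs) = insert (Suc (bar g l)) (letters (i, ps) - {bar g l})"
proof -
  have b: "prop_b g l (i, ps)" "\<not> prop_a g l (i, ps)" using assms prop_iff(1,3) by blast+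
  note bb = bar_bounds[OF h]
  have "bar g (l + 1) \<in> rights ps" "bar g l \<notin> rights ps"
    using r bb mem_letters_right[OF ne, of "bar g l"] mem_letters_right[OF ne, of "bar g (l + 1)"]
    by (auto simp: raisable_def)
  moreover have "theta g l (i, ps) = Some (i, replace_right (bar g (l + 1)) (bar g l) ps)"
    using b by (simp del: prop_a.simps prop_b.simps)
  ultimately show ?thesis
    using that replace_right_nested[OF ne, of "bar g (l + 1)" "bar g l"] bb by simp
qed

lemma rho_second:
  assumes h: "has_bar g l" and r: "lowerable (bar g l) (letters (i, ps))"
    and "\<not> raisable l (letters (i, ps))"
  obtains qs where "rho g l (i, ps) = Some (i, qs)" "nested g i qs"
    "letters (i, qs) = insert (bar g l) (letters (i, ps) - {Suc (bar g l)})"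
proof -
  have d: "prop_d g l (i, ps)" "\<not> prop_c g l (i, ps)" using assms prop_iff(4,5) by blast+
  note bb = bar_bounds[OF h]
  have "bar g (l + 1) \<notin> rights ps" "bar g l \<in> rights ps"
    using r bb mem_letters_right[OF ne, of "bar g l"] mem_letters_right[OF ne, of "bar g (l + 1)"]
    by (auto simp: lowerable_def)
  moreover have "rho g l (i, ps) = Some (i, replace_right (bar g l) (bar g (l + 1)) ps)"
    using d by (simp del: prop_c.simps prop_d.simps)
  ultimately show ?thesis
    using that replace_right_nested[OF ne, of "bar g l" "bar g (l + 1)"] bb by simp
qed

end

section \<open>Action on single components\<close>

text \<open>
  The contribution of a single component to \<open>\<tau>\<close> and to \<open>\<sigma>\<close>. These are the values of
  \<open>\<epsilon>\<^sub>l\<close> and \<open>\<phi>\<^sub>l\<close> on the component, and each is \<open>0\<close>, \<open>1\<close> or \<open>2\<close>.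
\<close>

definition comp_eps :: "cartan_type \<Rightarrow> nat \<Rightarrow> rseq \<Rightarrow> nat" where
  "comp_eps g l x = of_bool (prop_c g l x \<or> prop_d g l x) + of_bool (prop_d' g l x)"

definition comp_phi :: "cartan_type \<Rightarrow> nat \<Rightarrow> rseq \<Rightarrow> nat" where
  "comp_phi g l x = of_bool (prop_a g l x \<or> prop_b g l x) + of_bool (prop_a' g l x)"

lemma components_iff:
  "(i, ps) \<in> components g \<longleftrightarrow> i \<in> index_set g \<and> nested g i ps \<and> admissible g (letters (i, ps))"
proof -
  have "(i, ps) \<in> components g \<longleftrightarrow> i \<in> index_set g \<and> (\<exists>s. (i, ps) \<in> Rset g i s)"
    by (auto simp: components_def Rset_def)
  then show ?thesis using Rset_iff_admissible by blast
qed

lemma raisable_move: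
  assumes "raisable p J"
  shows "lowerable p (insert (Suc p) (J - {p}))" "\<not> raisable p (insert (Suc p) (J - {p}))"
    and "insert p (insert (Suc p) (J - {p}) - {Suc p}) = J"
    and "q \<noteq> p \<Longrightarrow> q \<noteq> Suc p \<Longrightarrow> p \<noteq> Suc q \<Longrightarrow> raisable q (insert (Suc p) (J - {p})) \<longleftrightarrow> raisable q J"
    and "q \<noteq> p \<Longrightarrow> q \<noteq> Suc p \<Longrightarrow> p \<noteq> Suc q \<Longrightarrow> lowerable q (insert (Suc p) (J - {p})) \<longleftrightarrow> lowerable q J"
  using assms by (auto simp: raisable_def lowerable_def)

lemma lowerable_move:
  assumes "lowerable p J"
  shows "raisable p (insert p (J - {Suc p}))" "\<not> lowerable p (insert p (J - {Suc p}))"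
    and "insert (Suc p) (insert p (J - {Suc p}) - {p}) = J"
    and "q \<noteq> p \<Longrightarrow> q \<noteq> Suc p \<Longrightarrow> p \<noteq> Suc q \<Longrightarrow> raisable q (insert p (J - {Suc p})) \<longleftrightarrow> raisable q J"
    and "q \<noteq> p \<Longrightarrow> q \<noteq> Suc p \<Longrightarrow> p \<noteq> Suc q \<Longrightarrow> lowerable q (insert p (J - {Suc p})) \<longleftrightarrow> lowerable q J"
  using assms by (auto simp: raisable_def lowerable_def)

lemma raisable_lowerable: "\<not> (raisable p J \<and> lowerable p J)"
  by (simp add: raisable_def lowerable_def)

lemma comp_stat_eq:
  assumes "(i, ps) \<in> components g" "l \<in> index_set g"
  shows "comp_phi g l (i, ps) =
      of_bool (raisable l (letters (i, ps)) \<and> \<not> (has_bar g l \<and> lowerable (bar g l) (letters (i, ps))) \<or>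
        \<not> raisable l (letters (i, ps)) \<and> has_bar g l \<and> raisable (bar g l) (letters (i, ps)))
      + of_bool (raisable l (letters (i, ps)) \<and> has_bar g l \<and> raisable (bar g l) (letters (i, ps)))"
    and "comp_eps g l (i, ps) =
      of_bool (lowerable l (letters (i, ps)) \<and> \<not> (has_bar g l \<and> lowerable (bar g l) (letters (i, ps))) \<or>
        \<not> raisable l (letters (i, ps)) \<and> has_bar g l \<and> lowerable (bar g l) (letters (i, ps)))
      + of_bool (lowerable l (letters (i, ps)) \<and> has_bar g l \<and> lowerable (bar g l) (letters (i, ps)))"
proof -
  have ne: "nested g i ps" and i: "i \<in> index_set g" using assms(1) by (auto simp: components_iff)
  note p = prop_iff[OF ne i assms(2)]
  show "comp_phi g l (i, ps) =
      of_bool (raisable l (letters (i, ps)) \<and> \<not> (has_bar g l \<and> lowerable (bar g l) (letters (i, ps))) \<or>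
        \<not> raisable l (letters (i, ps)) \<and> has_bar g l \<and> raisable (bar g l) (letters (i, ps)))
      + of_bool (raisable l (letters (i, ps)) \<and> has_bar g l \<and> raisable (bar g l) (letters (i, ps)))"
    unfolding comp_phi_def p ..
  show "comp_eps g l (i, ps) =
      of_bool (lowerable l (letters (i, ps)) \<and> \<not> (has_bar g l \<and> lowerable (bar g l) (letters (i, ps))) \<or>
        \<not> raisable l (letters (i, ps)) \<and> has_bar g l \<and> lowerable (bar g l) (letters (i, ps)))
      + of_bool (lowerable l (letters (i, ps)) \<and> has_bar g l \<and> lowerable (bar g l) (letters (i, ps)))"
    unfolding comp_eps_def p ..
qed

lemma theta_eq_None_iff: "theta g l x = None \<longleftrightarrow> comp_phi g l x = 0"
  by (cases x) (auto simp: comp_phi_def simp del: cond_a.simps cond_or.simps)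

lemma rho_eq_None_iff: "rho g l x = None \<longleftrightarrow> comp_eps g l x = 0"
proof (cases x)
  case (Pair i ps)
  have "prop_d' g l (i, ps) \<Longrightarrow> prop_d g l (i, ps) \<or> prop_c g l (i, ps)"
    by (auto split: if_splits)
  then show ?thesis unfolding Pair by (simp add: comp_eps_def del: prop_c.simps prop_d.simps prop_d'.simps) blast
qed

text \<open>
  Raising at \<open>l\<close> and lowering at \<open>bar l\<close> move no letter into a zone, so they preserve
  admissibility. For \<open>l < n\<close>, lowering at \<open>l\<close> and raising at \<open>bar l\<close> move a letter into the zone
  of size \<open>l\<close>;
  the condition on the other place, which the signature rule imposes, leaves room for it.
\<close>

lemma admissible_raise_first:
  assumes "admissible g J" "finite J" "raisable l J" "l \<in> index_set g"
  shows "admissible g (insert (Suc l) (J - {l}))"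
  using assms
  by (intro admissible_move) (auto simp: raisable_def index_set_def zone_def)

lemma admissible_lower_second:
  assumes "admissible g J" "finite J" "lowerable (bar g l) J" "l \<in> index_set g" "has_bar g l"
  shows "admissible g (insert (bar g l) (J - {Suc (bar g l)}))"
  using assms
  by (intro admissible_move) (auto simp: lowerable_def index_set_def zone_def has_bar_def)

lemma admissible_lower_first:
  assumes "admissible g J" "finite J" "J \<subseteq> {1..Suc (max_index g)}" "lowerable l J"
    and "\<not> (has_bar g l \<and> lowerable (bar g l) J)" "l \<in> index_set g"
  shows "admissible g (insert l (J - {Suc l}))"
proof (intro admissible_move assms(1,2))
  show "Suc l \<in> J" "l \<notin> J" using assms(4) by (auto simp: lowerable_def)
  fix n m assume g: "g = TypeC n" and m: "m \<le> n"
  have l: "1 \<le> l" "l \<le> n" using assms(6) g by (auto simp: index_set_def)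
  show "(l \<in> zone n m \<longrightarrow> Suc l \<in> zone n m) \<or> card (J \<inter> zone n m) < m"
  proof (cases "m = l \<and> l < n")
    case True
    then have "card (J \<inter> zone n l) < l"
      using assms g l by (intro admissible_room) (auto simp: lowerable_def has_bar_def)
    then show ?thesis using True by blast
  next
    case False
    then show ?thesis using l m by (auto simp: zone_def)
  qed
qed

lemma admissible_raise_second:
  assumes "admissible g J" "finite J" "J \<subseteq> {1..Suc (max_index g)}" "raisable (bar g l) J"
    and "\<not> raisable l J" "l \<in> index_set g" "has_bar g l"
  shows "admissible g (insert (Suc (bar g l)) (J - {bar g l}))"
proof (intro admissible_move assms(1,2))
  show "bar g l \<in> J" "Suc (bar g l) \<notin> J" using assms(4) by (auto simp: raisable_def)
  fix n m assume g: "g = TypeC n" and m: "m \<le> n"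
  have l: "1 \<le> l" "l < n" using assms(6,7) g by (auto simp: index_set_def has_bar_def)
  show "(Suc (bar g l) \<in> zone n m \<longrightarrow> bar g l \<in> zone n m) \<or> card (J \<inter> zone n m) < m"
  proof (cases "m = l")
    case True
    then have "card (J \<inter> zone n l) < l"
      using assms g l by (intro admissible_room) (auto simp: raisable_def)
    then show ?thesis using True by blast
  next
    case False
    then show ?thesis using l m g by (auto simp: zone_def)
  qed
qed

lemma letters_subset:
  assumes "nested g i ps" "i \<in> index_set g"
  shows "letters (i, ps) \<subseteq> {1..Suc (max_index g)}"
  using letters_bounds[OF assms] by auto

text \<open>
  The map \<open>\<theta>\<close> acts on a component like a crystal operator: the column after the move has the
  signature required for \<open>\<rho>\<close> to undo it, and columns determine sequences.
\<close>

lemma theta_Some: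
  assumes x: "x \<in> components g" and l: "l \<in> index_set g" and y: "theta g l x = Some y"
  shows "y \<in> components g" "fst y = fst x"
    and "comp_eps g l y = comp_eps g l x + 1" "comp_phi g l x = comp_phi g l y + 1"
    and "rho g l y = Some x"
    and "\<exists>p. (p = l \<or> has_bar g l \<and> p = bar g l) \<and> raisable p (letters x) \<and>
      letters y = insert (Suc p) (letters x - {p})"
proof -
  obtain i ps where xp: "x = (i, ps)" by (cases x)
  have ne: "nested g i ps" and i: "i \<in> index_set g" and adm: "admissible g (letters (i, ps))"
    using x by (auto simp: xp components_iff)
  note fin = finite_letters[of "(i, ps)"] and sub = letters_subset[OF ne i]
  let ?J = "letters (i, ps)" and ?m = "bar g l"
  have far: "?m \<noteq> l \<and> ?m \<noteq> Suc l \<and> l \<noteq> Suc ?m" if "has_bar g l"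
    using bar_bounds(4)[OF ne i l that] by linarith
  have "comp_phi g l x \<noteq> 0" using y theta_eq_None_iff[of g l x] by simp
  then consider (first) "raisable l ?J" "\<not> (has_bar g l \<and> lowerable ?m ?J)"
    | (second) "has_bar g l" "raisable ?m ?J" "\<not> raisable l ?J"
    using comp_stat_eq(1)[OF x[unfolded xp] l] raisable_lowerable[of ?m ?J] unfolding xp
    by (auto split: if_splits)
  then have "y \<in> components g \<and> fst y = fst x \<and> comp_eps g l y = comp_eps g l x + 1 \<and>
    comp_phi g l x = comp_phi g l y + 1 \<and> rho g l y = Some x \<and>
    (\<exists>p. (p = l \<or> has_bar g l \<and> p = ?m) \<and> raisable p (letters x) \<and>
      letters y = insert (Suc p) (letters x - {p}))"
  proof cases
    case first
    obtain qs where qs: "theta g l (i, ps) = Some (i, qs)" "nested g i qs"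
      "letters (i, qs) = insert (Suc l) (?J - {l})"
      by (rule theta_first[OF ne i l first])
    have yq: "y = (i, qs)" using qs(1) y by (simp add: xp)
    have yc: "(i, qs) \<in> components g"
      using admissible_raise_first[OF adm fin first(1) l] qs(2,3) i by (simp add: components_iff)
    note mv = raisable_move[OF first(1), folded qs(3)]
    have bits: "has_bar g l \<Longrightarrow> lowerable ?m (letters (i, qs)) \<longleftrightarrow> lowerable ?m ?J"
      "has_bar g l \<Longrightarrow> raisable ?m (letters (i, qs)) \<longleftrightarrow> raisable ?m ?J"
      using mv(4,5)[of ?m] far by blast+
    obtain rs where rs: "rho g l (i, qs) = Some (i, rs)" "nested g i rs"
      "letters (i, rs) = insert l (letters (i, qs) - {Suc l})"
      by (rule rho_first[OF qs(2) i l]) (use mv(1) bits first(2) in blast)+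
    have "rs = ps" using letters_inj[OF rs(2) ne] rs(3) mv(3) by simp
    moreover have "comp_eps g l (i, qs) = comp_eps g l (i, ps) + 1 \<and>
        comp_phi g l (i, ps) = comp_phi g l (i, qs) + 1"
      using first mv(1,2) bits raisable_lowerable[of l ?J] raisable_lowerable[of ?m ?J]
      unfolding comp_stat_eq[OF yc l] comp_stat_eq[OF x[unfolded xp] l]
      by (cases "has_bar g l"; cases "raisable ?m ?J") auto
    ultimately show ?thesis using yc rs(1) first(1) qs(3) by (auto simp: yq xp)
  next
    case second
    obtain qs where qs: "theta g l (i, ps) = Some (i, qs)" "nested g i qs"
      "letters (i, qs) = insert (Suc ?m) (?J - {?m})"
      by (rule theta_second[OF ne i l second])
    have yq: "y = (i, qs)" using qs(1) y by (simp add: xp)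
    have yc: "(i, qs) \<in> components g"
      using admissible_raise_second[OF adm fin sub second(2,3) l second(1)] qs(2,3) i
      by (simp add: components_iff)
    note mv = raisable_move[OF second(2), folded qs(3)]
    have bits: "lowerable l (letters (i, qs)) \<longleftrightarrow> lowerable l ?J"
      "raisable l (letters (i, qs)) \<longleftrightarrow> raisable l ?J"
      using mv(4,5)[of l] far[OF second(1)] by auto
    obtain rs where rs: "rho g l (i, qs) = Some (i, rs)" "nested g i rs"
      "letters (i, rs) = insert ?m (letters (i, qs) - {Suc ?m})"
      by (rule rho_second[OF qs(2) i l second(1) mv(1)]) (use bits second(3) in blast)+
    have "rs = ps" using letters_inj[OF rs(2) ne] rs(3) mv(3) by simp
    moreover have "comp_eps g l (i, qs) = comp_eps g l (i, ps) + 1 \<and>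
        comp_phi g l (i, ps) = comp_phi g l (i, qs) + 1"
      using second mv(1,2) bits raisable_lowerable[of ?m ?J]
      unfolding comp_stat_eq[OF yc l] comp_stat_eq[OF x[unfolded xp] l]
      by (cases "lowerable l ?J") auto
    ultimately show ?thesis using yc rs(1) second qs(3) by (auto simp: yq xp)
  qed
  then show "y \<in> components g" "fst y = fst x"
    "comp_eps g l y = comp_eps g l x + 1" "comp_phi g l x = comp_phi g l y + 1"
    "rho g l y = Some x"
    "\<exists>p. (p = l \<or> has_bar g l \<and> p = ?m) \<and> raisable p (letters x) \<and>
      letters y = insert (Suc p) (letters x - {p})"
    by blast+
qed

lemma rho_Some:
  assumes x: "x \<in> components g" and l: "l \<in> index_set g" and y: "rho g l x = Some y"
  shows "y \<in> components g" "theta g l y = Some x"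
proof -
  obtain i ps where xp: "x = (i, ps)" by (cases x)
  have ne: "nested g i ps" and i: "i \<in> index_set g" and adm: "admissible g (letters (i, ps))"
    using x by (auto simp: xp components_iff)
  note fin = finite_letters[of "(i, ps)"] and sub = letters_subset[OF ne i]
  let ?J = "letters (i, ps)" and ?m = "bar g l"
  have far: "?m \<noteq> l \<and> ?m \<noteq> Suc l \<and> l \<noteq> Suc ?m" if "has_bar g l"
    using bar_bounds(4)[OF ne i l that] by linarith
  have "comp_eps g l x \<noteq> 0" using y rho_eq_None_iff[of g l x] by simp
  then consider (first) "lowerable l ?J" "\<not> (has_bar g l \<and> lowerable ?m ?J)"
    | (second) "has_bar g l" "lowerable ?m ?J" "\<not> raisable l ?J"
    using comp_stat_eq(2)[OF x[unfolded xp] l] raisable_lowerable[of l ?J] unfolding xp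
    by (auto split: if_splits)
  then have "y \<in> components g \<and> theta g l y = Some x"
  proof cases
    case first
    obtain qs where qs: "rho g l (i, ps) = Some (i, qs)" "nested g i qs"
      "letters (i, qs) = insert l (?J - {Suc l})"
      by (rule rho_first[OF ne i l first])
    have yq: "y = (i, qs)" using qs(1) y by (simp add: xp)
    have yc: "(i, qs) \<in> components g"
      using admissible_lower_first[OF adm fin sub first l] qs(2,3) i by (simp add: components_iff)
    note mv = lowerable_move[OF first(1), folded qs(3)]
    have bits: "has_bar g l \<Longrightarrow> lowerable ?m (letters (i, qs)) \<longleftrightarrow> lowerable ?m ?J"
      using mv(5)[of ?m] far by blast
    obtain rs where rs: "theta g l (i, qs) = Some (i, rs)" "nested g i rs"
      "letters (i, rs) = insert (Suc l) (letters (i, qs) - {l})"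
      by (rule theta_first[OF qs(2) i l]) (use mv(1) bits first(2) in blast)+
    have "rs = ps" using letters_inj[OF rs(2) ne] rs(3) mv(3) by simp
    then show ?thesis using yc rs(1) by (simp add: yq xp)
  next
    case second
    obtain qs where qs: "rho g l (i, ps) = Some (i, qs)" "nested g i qs"
      "letters (i, qs) = insert ?m (?J - {Suc ?m})"
      by (rule rho_second[OF ne i l second])
    have yq: "y = (i, qs)" using qs(1) y by (simp add: xp)
    have yc: "(i, qs) \<in> components g"
      using admissible_lower_second[OF adm fin second(2) l second(1)] qs(2,3) i
      by (simp add: components_iff)
    note mv = lowerable_move[OF second(2), folded qs(3)]
    have bits: "raisable l (letters (i, qs)) \<longleftrightarrow> raisable l ?J"
      using mv(4)[of l] far[OF second(1)] by auto
    obtain rs where rs: "theta g l (i, qs) = Some (i, rs)" "nested g i rs"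
      "letters (i, rs) = insert (Suc ?m) (letters (i, qs) - {?m})"
      by (rule theta_second[OF qs(2) i l second(1) mv(1)]) (use bits second(3) in blast)+
    have "rs = ps" using letters_inj[OF rs(2) ne] rs(3) mv(3) by simp
    then show ?thesis using yc rs(1) by (simp add: yq xp)
  qed
  then show "y \<in> components g" "theta g l y = Some x" by blast+
qed

section \<open>Weights of columns\<close>

text \<open>
  The value of the \<open>l\<close>-th simple coroot on the weight of the letter \<open>j\<close>. The letter \<open>j \<le> n\<close> has
  weight \<open>\<omega>\<^sub>j - \<omega>\<^sub>j\<^sub>-\<^sub>1\<close>, where \<open>\<omega>\<^sub>0 = 0\<close>. The last letter of type \<open>A\<close> has weight
  \<open>-\<omega>\<^sub>n\<close>, and in type \<open>C\<close> the weights of \<open>j\<close> and \<open>2n + 1 - j\<close> are opposite.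
\<close>

definition letter_wt :: "cartan_type \<Rightarrow> nat \<Rightarrow> nat \<Rightarrow> int" where
  "letter_wt g l j = of_bool (j = l) - of_bool (j = Suc l) +
     (if has_bar g l then of_bool (j = bar g l) - of_bool (j = Suc (bar g l)) else 0)"

text \<open>
  The simple root \<open>\<alpha>\<^sub>m\<close> is the difference of the weights of \<open>m\<close> and \<open>m + 1\<close>, and in type \<open>C\<close>
  for \<open>m < n\<close> also of \<open>bar m\<close> and \<open>bar m + 1\<close>. Therefore the root \<open>\<alpha>\<close> indexed by \<open>a, a'\<close> telescopes to the difference of the weights of
  \<open>a\<close> and \<open>a' + 1\<close>.
\<close>

lemma cartan_letter_wt:
  assumes "l \<in> index_set g" "m \<in> index_set g"
  shows "cartan g l m = letter_wt g l m - letter_wt g l (Suc m)"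
proof (cases "has_bar g l")
  case False
  then show ?thesis
    using assms by (cases g) (auto simp: cartan_def letter_wt_def has_bar_def index_set_def)
next
  case True
  then obtain n where g: "g = TypeC n" "l \<noteq> n" by (auto simp: has_bar_def)
  then have b: "1 \<le> l" "l < n" "1 \<le> m" "m \<le> n" using assms by (auto simp: index_set_def)
  then have "m \<noteq> bar g l" "m \<noteq> Suc (bar g l)" "Suc m = bar g l \<longleftrightarrow> l + 1 = n \<and> m = n"
    using g by auto
  then show ?thesis
    using b g True by (simp add: cartan_def letter_wt_def of_bool_def)
qed

lemma cartan_letter_wt_bar:
  assumes "l \<in> index_set g" "m \<in> index_set g" "has_bar g m"
  shows "cartan g l m = letter_wt g l (bar g m) - letter_wt g l (Suc (bar g m))"
proof -
  obtain n where g: "g = TypeC n" "m \<noteq> n" using assms(3) by (auto simp: has_bar_def)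
  then have b: "1 \<le> l" "l \<le> n" "1 \<le> m" "m < n" using assms by (auto simp: index_set_def)
  then have "bar g m \<noteq> l" "Suc (bar g m) \<noteq> l" "Suc (bar g m) \<noteq> Suc l"
      "bar g m = Suc l \<longleftrightarrow> l = n \<and> Suc m = n"
    using g by auto
  moreover have "bar g m = bar g l \<longleftrightarrow> m = l" "bar g m = Suc (bar g l) \<longleftrightarrow> Suc m = l"
      "Suc (bar g m) = bar g l \<longleftrightarrow> Suc l = m"
    using g b by auto
  ultimately show ?thesis
    using b g by (auto simp: cartan_def letter_wt_def has_bar_def simp del: bar.simps)
qed

lemma lookup_simple_root:
  "Poly_Mapping.lookup (simple_root g m) k = (if k \<in> index_set g then cartan g k m else 0)"
proof -
  have "finite (index_set g)" by (simp add: index_set_def)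
  then show ?thesis
    by (simp add: simple_root_def lookup_sum fundamental_weight_def lookup_single when_def if_distrib
        cong: if_cong)
qed

lemma telescope:
  fixes f :: "nat \<Rightarrow> int"
  assumes "a \<le> Suc b"
  shows "(\<Sum>m=a..b. f m - f (Suc m)) = f a - f (Suc b)"
  using sum_Suc_diff[OF assms, of "\<lambda>m. - f m"] by simp

lemma lookup_segment_root:
  assumes k: "k \<in> index_set g" and a: "1 \<le> a" "a \<le> lie_rank g" "a \<le> a'" "a' \<le> max_index g"
  shows "Poly_Mapping.lookup (segment_root g a a') k = letter_wt g k a - letter_wt g k (Suc a')"
proof -
  let ?n = "lie_rank g"
  have up: "(\<Sum>m=a..b. Poly_Mapping.lookup (simple_root g m) k) = letter_wt g k a - letter_wt g k (Suc b)"
    if b: "b \<le> ?n" "a \<le> b" for b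
  proof -
    have "(\<Sum>m=a..b. Poly_Mapping.lookup (simple_root g m) k) =
        (\<Sum>m=a..b. letter_wt g k m - letter_wt g k (Suc m))"
      using k b a by (intro sum.cong refl) (auto simp: lookup_simple_root cartan_letter_wt index_set_def)
    then show ?thesis using telescope[of a b] b by simp
  qed
  show ?thesis
  proof (cases "a' \<le> ?n")
    case True
    then show ?thesis using up[of a'] a by (simp add: segment_root_def lookup_sum)
  next
    case False
    then obtain n where g: "g = TypeC n" using a by (cases g) auto
    have down: "(\<Sum>m=b..<n. Poly_Mapping.lookup (simple_root g m) k) =
        letter_wt g k (Suc n) - letter_wt g k (Suc (2 * n - b))" if "1 \<le> b" "b \<le> n" for b
      using that(2,1)
    proof (induction b rule: inc_induct)
      case base
      then show ?case by (simp add: mult_2)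
    next
      case (step m)
      have "Suc (2 * n - Suc m) = 2 * n - m" using step.hyps by simp
      moreover have "Poly_Mapping.lookup (simple_root g m) k =
          letter_wt g k (2 * n - m) - letter_wt g k (Suc (2 * n - m))"
        using cartan_letter_wt_bar[OF k, of m] step k g
        by (simp add: lookup_simple_root index_set_def has_bar_def)
      ultimately show ?case
        using step by (simp add: sum.atLeast_Suc_lessThan)
    qed
    have "2 * n - (2 * n - a') = a'" "1 \<le> 2 * n - a'" "2 * n - a' \<le> n" using a False g by auto
    then show ?thesis
      using False up[of n] down[of "2 * n - a'"] a g
      by (simp add: segment_root_def lookup_sum lookup_add)
  qed
qed

lemma lookup_rseq_wt_outside:
  assumes "k \<notin> index_set g"
  shows "Poly_Mapping.lookup (rseq_wt g x) k = 0"
proof (cases x)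
  case (Pair i ps)
  show ?thesis
    using assms unfolding Pair
    by (induction ps)
      (auto simp: segment_root_def Let_def lookup_add lookup_sum lookup_simple_root)
qed

text \<open>
  The \<open>k\<close>-th coordinate of the contribution \<open>\<omega>\<^sub>i - wt(x)\<close> of a component to the weight. For
  \<open>k \<in> I\<close>, it is the \<open>k\<close>-th coordinate of the sum of the weights of the letters of the column.
\<close>

definition comp_coord :: "cartan_type \<Rightarrow> rseq \<Rightarrow> nat \<Rightarrow> int" where
  "comp_coord g x k = of_bool (fst x = k) - Poly_Mapping.lookup (rseq_wt g x) k"

lemma comp_coord_eq:
  assumes x: "(i, ps) \<in> components g" and k: "k \<in> index_set g"
  shows "comp_coord g (i, ps) k = (\<Sum>j\<in>letters (i, ps). letter_wt g k j)"
proof -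
  have ne: "nested g i ps" and i: "i \<in> index_set g" using x by (auto simp: components_iff)
  have i': "1 \<le> i" "i \<le> lie_rank g" using i by (auto simp: index_set_def)
  note inj = nested_inj[OF ne]
  have d: "distinct ps"
    using ne by (auto simp: nested_def strict_sorted_iff distinct_map)
  have "Poly_Mapping.lookup (rseq_wt g (i, ps)) k =
      (\<Sum>p\<in>set ps. Poly_Mapping.lookup (segment_root g (fst p) (snd p)) k)"
    using d by (simp add: lookup_sum sum_list_distinct_conv_sum_set split_beta)
  also have "\<dots> = (\<Sum>p\<in>set ps. letter_wt g k (fst p) - letter_wt g k (Suc (snd p)))"
    using ne i' k by (intro sum.cong refl lookup_segment_root) (auto simp: nested_def)
  also have "\<dots> = (\<Sum>j\<in>lefts ps. letter_wt g k j) - (\<Sum>j\<in>Suc ` rights ps. letter_wt g k j)"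
    using inj by (simp add: sum_subtractf sum.reindex)
  finally have 1: "Poly_Mapping.lookup (rseq_wt g (i, ps)) k = \<dots>" .
  have "(\<Sum>j\<in>letters (i, ps). letter_wt g k j) =
      (\<Sum>j\<in>{1..i} - lefts ps. letter_wt g k j) + (\<Sum>j\<in>Suc ` rights ps. letter_wt g k j)"
    unfolding letters_def fst_conv snd_conv
    using nested_rights[OF ne] by (intro sum.union_disjoint) force+
  also have "(\<Sum>j\<in>{1..i} - lefts ps. letter_wt g k j) =
      (\<Sum>j\<in>{1..i}. letter_wt g k j) - (\<Sum>j\<in>lefts ps. letter_wt g k j)"
    using ne by (intro sum_diff) (auto simp: nested_def)
  also have "(\<Sum>j\<in>{1..i}. letter_wt g k j) = of_bool (i = k)"
  proof -
    have "letter_wt g k j = of_bool (j = k) - of_bool (j = Suc k)" if "j \<in> {1..i}" for j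
      using that i' k by (auto simp: letter_wt_def has_bar_def index_set_def)
    then have "(\<Sum>j\<in>{1..i}. letter_wt g k j) = (\<Sum>j\<in>{1..i}. of_bool (j = k) - of_bool (j = Suc k))"
      by simp
    also have "\<dots> = of_bool (k \<in> {1..i}) - of_bool (Suc k \<in> {1..i})"
      by (simp only: sum_subtractf) (simp add: of_bool_def)
    finally show ?thesis using k by (auto simp: index_set_def)
  qed
  finally show ?thesis using 1 by (simp add: comp_coord_def)
qed

lemma comp_phi_minus_eps:
  assumes x: "x \<in> components g" and l: "l \<in> index_set g"
  shows "int (comp_phi g l x) - int (comp_eps g l x) = comp_coord g x l"
proof -
  obtain i ps where xp: "x = (i, ps)" by (cases x)
  let ?J = "letters (i, ps)" and ?m = "bar g l"
  have fin: "finite ?J" by (rule finite_letters)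
  have "comp_coord g (i, ps) l = of_bool (l \<in> ?J) - of_bool (Suc l \<in> ?J) +
      (if has_bar g l then of_bool (?m \<in> ?J) - of_bool (Suc ?m \<in> ?J) else 0)"
    using fin unfolding comp_coord_eq[OF x[unfolded xp] l] letter_wt_def
    by (simp add: sum.distrib sum_subtractf of_bool_def)
  then show ?thesis
    unfolding xp comp_stat_eq[OF x[unfolded xp] l]
    by (cases "has_bar g l") (auto simp: raisable_def lowerable_def)
qed

lemma comp_coord_theta:
  assumes x: "x \<in> components g" and l: "l \<in> index_set g" and y: "theta g l x = Some y"
  shows "comp_coord g y k = comp_coord g x k - Poly_Mapping.lookup (simple_root g l) k"
proof (cases "k \<in> index_set g")
  case False
  then show ?thesis
    using theta_Some(2)[OF x l y]
    by (simp add: comp_coord_def lookup_rseq_wt_outside lookup_simple_root)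
next
  case k: True
  obtain p where p: "p = l \<or> has_bar g l \<and> p = bar g l" "raisable p (letters x)"
    "letters y = insert (Suc p) (letters x - {p})"
    using theta_Some(6)[OF x l y] by blast
  have c: "comp_coord g z k = (\<Sum>j\<in>letters z. letter_wt g k j)" if "z \<in> components g" for z
    using comp_coord_eq[of "fst z" "snd z" g k] that k by simp
  have "(\<Sum>j\<in>letters y. letter_wt g k j) =
      (\<Sum>j\<in>letters x. letter_wt g k j) - (letter_wt g k p - letter_wt g k (Suc p))"
    using p(2) finite_letters[of x] unfolding p(3) raisable_def by (simp add: sum_diff1)
  moreover have "letter_wt g k p - letter_wt g k (Suc p) = Poly_Mapping.lookup (simple_root g l) k"
    using p(1) cartan_letter_wt[OF k l] cartan_letter_wt_bar[OF k l] k by (auto simp: lookup_simple_root)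
  ultimately show ?thesis using c[OF x] c[OF theta_Some(1)[OF x l y]] by simp
qed

section \<open>Signature rule for infinite sequences\<close>

text \<open>
  The difference \<open>\<sigma>\<^sub>l - \<tau>\<^sub>l\<close> at \<open>j\<close>, except that the first component also counts in \<open>\<tau>\<close>. This shifts
  all values by the same constant, hence leaves the positions of the minima unchanged, and makes all
  positions behave alike.
\<close>

definition height :: "cartan_type \<Rightarrow> nat \<Rightarrow> (nat \<Rightarrow> rseq option) \<Rightarrow> nat \<Rightarrow> int" where
  "height g l x j =
    (\<Sum>q\<in>{1..<j}. int (comp_phi g l (comp_at x q))) - (\<Sum>q\<in>{1..j}. int (comp_eps g l (comp_at x q)))"

lemma sum_of_bool_card: "finite A \<Longrightarrow> (\<Sum>q\<in>A. of_bool (P q) :: int) = int (card {q \<in> A. P q})"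
  by (simp add: Int_def)

lemma sigma_eq_sum:
  assumes "1 \<le> j"
  shows "sigma g l j x = (\<Sum>q\<in>{1..<j}. int (comp_phi g l (comp_at x q)))"
proof -
  have "{1..j - 1} = {1..<j}" using assms by auto
  then show ?thesis
    by (cases "j = 1") (simp_all add: sigma_def comp_phi_def sum.distrib sum_of_bool_card Int_def
      conj_assoc del: of_bool_or_iff)
qed

lemma tau_eq_sum:
  assumes "1 \<le> j"
  shows "tau g l j x = (\<Sum>q\<in>{2..j}. int (comp_eps g l (comp_at x q)))"
  by (cases "j = 1") (simp_all add: tau_def comp_eps_def sum.distrib sum_of_bool_card Int_def
      conj_assoc del: of_bool_or_iff)

lemma sigma_minus_tau:
  assumes "1 \<le> j"
  shows "sigma g l j x - tau g l j x = height g l x j + int (comp_eps g l (comp_at x 1))"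
proof -
  have "{1..j} = insert 1 {2..j}" using assms by auto
  then have "(\<Sum>q\<in>{1..j}. int (comp_eps g l (comp_at x q))) =
      int (comp_eps g l (comp_at x 1)) + (\<Sum>q\<in>{2..j}. int (comp_eps g l (comp_at x q)))"
    by (simp only:) simp
  then show ?thesis
    using assms by (simp add: sigma_eq_sum tau_eq_sum height_def)
qed

lemma height_1: "height g l x 1 = - int (comp_eps g l (comp_at x 1))"
  by (simp add: height_def)

lemma height_Suc:
  assumes "1 \<le> j"
  shows "height g l x (Suc j) =
    height g l x j + int (comp_phi g l (comp_at x j)) - int (comp_eps g l (comp_at x (Suc j)))"
  using assms by (simp add: height_def sum.atLeastLessThan_Suc)

definition height_min :: "cartan_type \<Rightarrow> nat \<Rightarrow> (nat \<Rightarrow> rseq option) \<Rightarrow> int" where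
  "height_min g l x = Min (height g l x ` {1..num_comps x})"

lemma height_min_le:
  assumes "j \<in> {1..num_comps x}"
  shows "height_min g l x \<le> height g l x j"
  using assms by (simp add: height_min_def)

lemma height_min_eqI:
  assumes "p \<in> {1..num_comps x}" "\<And>j. j \<in> {1..num_comps x} \<Longrightarrow> height g l x p \<le> height g l x j"
  shows "height_min g l x = height g l x p"
  unfolding height_min_def using assms by (intro Min_eqI) auto

lemma mu_eq:
  assumes "0 < num_comps x"
  shows "mu g l x = height_min g l x + int (comp_eps g l (comp_at x 1))"
proof -
  let ?H = "height g l x" and ?c = "int (comp_eps g l (comp_at x 1))"
  have "mu g l x = Min ((\<lambda>j. ?H j + ?c) ` {1..num_comps x})"
    unfolding mu_def by (intro arg_cong[where f = Min] image_cong) (auto simp: sigma_minus_tau)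
  also have "\<dots> = Min (?H ` {1..num_comps x}) + ?c"
    using assms by (intro Min_add_commute) auto
  finally show ?thesis by (simp add: height_min_def)
qed

lemma argmin_set_eq:
  assumes "0 < num_comps x"
  shows "{p \<in> {1..num_comps x}. sigma g l p x - tau g l p x = mu g l x} =
    {p \<in> {1..num_comps x}. height g l x p = height_min g l x}"
  using assms by (auto simp: sigma_minus_tau mu_eq)

lemma argmin_set_nonempty:
  assumes "0 < num_comps x"
  shows "{p \<in> {1..num_comps x}. height g l x p = height_min g l x} \<noteq> {}"
proof -
  have "Min (height g l x ` {1..num_comps x}) \<in> height g l x ` {1..num_comps x}"
    using assms by (intro Min_in) auto
  then show ?thesis by (auto simp: height_min_def)
qed

text \<open>
  The operator \<open>f\<close> acts at the rightmost minimum of the height, and \<open>e\<close> at the leftmost one.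
\<close>

lemma f_index:
  assumes "0 < num_comps x"
  shows "f_index g l x \<in> {1..num_comps x}"
    and "height g l x (f_index g l x) = height_min g l x"
    and "j \<in> {1..num_comps x} \<Longrightarrow> f_index g l x < j \<Longrightarrow> height_min g l x < height g l x j"
proof -
  let ?S = "{p \<in> {1..num_comps x}. height g l x p = height_min g l x}"
  have eq: "f_index g l x = Max ?S" unfolding f_index_def argmin_set_eq[OF assms] ..
  have "Max ?S \<in> ?S" using argmin_set_nonempty[OF assms] by (intro Max_in) auto
  then have "f_index g l x \<in> ?S" by (simp only: eq)
  then show "f_index g l x \<in> {1..num_comps x}" "height g l x (f_index g l x) = height_min g l x"
    by blast+
  assume j: "j \<in> {1..num_comps x}" "f_index g l x < j"
  have "j \<notin> ?S"
  proof
    assume "j \<in> ?S"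
    then have "j \<le> Max ?S" by (intro Max_ge) auto
    then show False using j(2) unfolding eq by linarith
  qed
  then show "height_min g l x < height g l x j"
    using j(1) height_min_le[OF j(1), of g l] by auto
qed

lemma e_index:
  assumes "0 < num_comps x"
  shows "e_index g l x \<in> {1..num_comps x}"
    and "height g l x (e_index g l x) = height_min g l x"
    and "j \<in> {1..num_comps x} \<Longrightarrow> j < e_index g l x \<Longrightarrow> height_min g l x < height g l x j"
proof -
  let ?S = "{p \<in> {1..num_comps x}. height g l x p = height_min g l x}"
  have eq: "e_index g l x = Min ?S" unfolding e_index_def argmin_set_eq[OF assms] ..
  have "Min ?S \<in> ?S" using argmin_set_nonempty[OF assms] by (intro Min_in) auto
  then have "e_index g l x \<in> ?S" by (simp only: eq)
  then show "e_index g l x \<in> {1..num_comps x}" "height g l x (e_index g l x) = height_min g l x"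
    by blast+
  assume j: "j \<in> {1..num_comps x}" "j < e_index g l x"
  have "j \<notin> ?S"
  proof
    assume "j \<in> ?S"
    then have "Min ?S \<le> j" by (intro Min_le) auto
    then show False using j(2) unfolding eq by linarith
  qed
  then show "height_min g l x < height g l x j"
    using j(1) height_min_le[OF j(1), of g l] by auto
qed

lemma f_index_eqI:
  assumes "p \<in> {1..num_comps x}"
    and "\<And>j. j \<in> {1..num_comps x} \<Longrightarrow> height g l x p \<le> height g l x j"
    and "\<And>j. j \<in> {1..num_comps x} \<Longrightarrow> p < j \<Longrightarrow> height g l x p < height g l x j"
  shows "f_index g l x = p"
proof -
  have k: "0 < num_comps x" using assms(1) by auto
  have m: "height_min g l x = height g l x p" by (rule height_min_eqI[OF assms(1,2)])
  note f = f_index[OF k, where g = g and l = l]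
  show ?thesis
    using f(1,2) f(3)[OF assms(1)] assms(3)[OF f(1)] m by (cases "f_index g l x" p rule: linorder_cases) auto
qed

lemma e_index_eqI:
  assumes "p \<in> {1..num_comps x}"
    and "\<And>j. j \<in> {1..num_comps x} \<Longrightarrow> height g l x p \<le> height g l x j"
    and "\<And>j. j \<in> {1..num_comps x} \<Longrightarrow> j < p \<Longrightarrow> height g l x p < height g l x j"
  shows "e_index g l x = p"
proof -
  have k: "0 < num_comps x" using assms(1) by auto
  have m: "height_min g l x = height g l x p" by (rule height_min_eqI[OF assms(1,2)])
  note f = e_index[OF k, where g = g and l = l]
  show ?thesis
    using f(1,2) f(3)[OF assms(1)] assms(3)[OF f(1)] m by (cases "e_index g l x" p rule: linorder_cases) auto
qed

lemma Rinf_eps_eq: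
  assumes "0 < num_comps x"
  shows "Rinf_eps g l x = Fin (- height_min g l x)"
proof -
  let ?y = "(\<lambda>_. None)(0 := Some (1, []), 1 := Some (comp_at x 1)) :: nat \<Rightarrow> rseq option"
  have "support ?y = {0, 1}" by (auto simp: support_def)
  then have "pos ?y 2 = 1" by (simp add: pos_def)
  then have "comp_at ?y 2 = comp_at x 1" by (simp add: comp_at_def)
  then have "tau g l 2 ?y = int (comp_eps g l (comp_at x 1))" by (simp add: tau_eq_sum)
  then show ?thesis using assms by (simp add: Rinf_eps_def mu_eq)
qed

lemma Rinf_phi_eq:
  assumes "0 < num_comps x"
  shows "Rinf_phi g l x = Fin (height g l x (num_comps x)
    + int (comp_phi g l (comp_at x (num_comps x))) - height_min g l x)"
proof -
  let ?k = "num_comps x"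
  have "sigma g l (?k + 1) x = sigma g l ?k x + int (comp_phi g l (comp_at x ?k))"
    using assms by (simp add: sigma_eq_sum sum.atLeastLessThan_Suc)
  then show ?thesis
    using assms sigma_minus_tau[of ?k g l x] by (simp add: Rinf_phi_def mu_eq)
qed

lemma pos_bij:
  assumes "finite (support x)"
  shows "bij_betw (pos x) {1..num_comps x} (support x)"
proof -
  let ?L = "sorted_list_of_set (support x)"
  have "bij_betw ((!) ?L) {..<num_comps x} (support x)"
    using assms by (intro bij_betw_nth) (auto simp: num_comps_def)
  moreover have "bij_betw (\<lambda>p. p - 1) {1..num_comps x} {..<num_comps x}"
    by (rule bij_betw_byWitness[where f' = Suc]) auto
  ultimately have "bij_betw ((!) ?L \<circ> (\<lambda>p. p - 1)) {1..num_comps x} (support x)"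
    using bij_betw_trans by blast
  then show ?thesis by (simp add: pos_def comp_def cong: bij_betw_cong)
qed

context
  fixes x :: "nat \<Rightarrow> rseq option" and p :: nat
  assumes fin: "finite (support x)" and p: "p \<in> {1..num_comps x}"
begin

lemma pos_in_support: "pos x p \<in> support x"
  using pos_bij[OF fin] p by (auto simp: bij_betw_def)

lemma support_upd: "support (x(pos x p := Some y)) = support x"
  using pos_in_support by (auto simp: support_def)

lemma num_comps_upd: "num_comps (x(pos x p := Some y)) = num_comps x"
  by (simp add: num_comps_def support_upd)

lemma pos_upd: "pos (x(pos x p := Some y)) q = pos x q"
  by (simp only: pos_def[of "x(pos x p := Some y)"] support_upd pos_def[of x q])

lemma comp_at_upd:
  assumes "q \<in> {1..num_comps x}"
  shows "comp_at (x(pos x p := Some y)) q = (if q = p then y else comp_at x q)"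
proof -
  have "pos x q = pos x p \<longleftrightarrow> q = p"
    using inj_on_eq_iff[OF bij_betw_imp_inj_on[OF pos_bij[OF fin]]] assms p by blast
  then show ?thesis by (simp add: comp_at_def pos_upd)
qed

lemma upd_comp_at: "x(pos x p := Some (comp_at x p)) = x"
  using pos_in_support by (simp add: comp_at_def support_def fun_upd_idem)

text \<open>
  Changing \<open>(\<epsilon>, \<phi>)\<close> at the position \<open>p\<close> by \<open>(d, -d)\<close> lowers the height by \<open>d\<close> at \<open>p\<close> and by \<open>2d\<close>
  to the right of \<open>p\<close>.
\<close>

lemma height_upd:
  assumes "int (comp_eps g l y) = int (comp_eps g l (comp_at x p)) + d"
    and "int (comp_phi g l y) = int (comp_phi g l (comp_at x p)) - d"
    and "j \<in> {1..num_comps x}"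
  shows "height g l (x(pos x p := Some y)) j =
    height g l x j - (if j < p then 0 else if j = p then d else 2 * d)"
  using assms(3)
proof (induction j)
  case (Suc j)
  show ?case
  proof (cases "j = 0")
    case True
    have "1 \<in> {1..num_comps x}" using p by auto
    then have "height g l (x(pos x p := Some y)) 1 = height g l x 1 - (if 1 = p then d else 0)"
      using assms(1) by (simp only: height_1 comp_at_upd) simp
    then show ?thesis using True p by (auto split: if_splits simp del: fun_upd_apply)
  next
    case False
    have eq: "height g l (x(pos x p := Some y)) (Suc j) = height g l (x(pos x p := Some y)) j
        + int (comp_phi g l (if j = p then y else comp_at x j))
        - int (comp_eps g l (if Suc j = p then y else comp_at x (Suc j)))"
      using Suc.prems False by (simp add: height_Suc comp_at_upd del: fun_upd_apply)
    consider "Suc j < p" | "p = Suc j" | "p = j" | "p < j" by linarith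
    then show ?thesis
      using Suc False assms(1,2) eq height_Suc[of j g l x]
      by cases (simp_all del: fun_upd_apply)
  qed
qed simp

end

lemma iterate_op_Suc: "iterate_op h (Suc k) b = Option.bind (h b) (iterate_op h k)"
proof -
  have "iterate_op h (Suc k) b = ((\<lambda>y. Option.bind y h) ^^ k) (h b)"
    by (simp add: iterate_op_def funpow_Suc_right del: funpow.simps)
  moreover have "((\<lambda>y. Option.bind y h) ^^ k) None = None" by (induction k) auto
  ultimately show ?thesis by (cases "h b") (simp_all add: iterate_op_def)
qed

text \<open>
  If \<open>v\<close> drops by one whenever \<open>h\<close> applies and vanishes exactly where \<open>h\<close> does not apply, and if
  its value at \<open>b\<close> is a natural number, then this value counts how often \<open>h\<close> can be applied to \<open>b\<close>.
\<close>

lemma has_max_value_iterate: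
  fixes v :: "'b \<Rightarrow> int extended"
  assumes "b \<in> B" "v b = Fin (int m)"
    and zero: "\<And>b. b \<in> B \<Longrightarrow> h b = None \<longleftrightarrow> v b = Fin 0"
    and step: "\<And>b b'. b \<in> B \<Longrightarrow> h b = Some b' \<Longrightarrow> b' \<in> B \<and> v b' = v b - Fin 1"
  shows "has_max_value (v b) {k. iterate_op h k b \<noteq> None}"
proof -
  have "iterate_op h k b \<noteq> None \<longleftrightarrow> k \<le> m" for k
    using assms(1,2)
  proof (induction k arbitrary: b m)
    case 0
    then show ?case by (simp add: iterate_op_def)
  next
    case (Suc k)
    show ?case
    proof (cases "h b")
      case None
      then show ?thesis using Suc.prems zero[of b] by (simp add: iterate_op_Suc)
    next
      case (Some b')
      then have "m \<noteq> 0" using Suc.prems zero[of b] by auto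
      then have "v b' = Fin (int (m - 1))"
        using step[OF Suc.prems(1) Some] Suc.prems(2) by (simp add: of_nat_diff)
      with step[OF Suc.prems(1) Some] have "iterate_op h k b' \<noteq> None \<longleftrightarrow> k \<le> m - 1"
        by (intro Suc.IH) auto
      then show ?thesis using \<open>m \<noteq> 0\<close> Some by (auto simp: iterate_op_Suc)
    qed
  qed
  then have "{k. iterate_op h k b \<noteq> None} = {..m}" by auto
  moreover have "Max {..m} = m" by (rule Max_eqI) auto
  ultimately show ?thesis using assms(2) by (simp add: has_max_value_def)
qed

section \<open>Crystal operators on infinite sequences\<close>

lemma Rinf_iff:
  "x \<in> Rinf g \<longleftrightarrow> finite (support x) \<and> (\<forall>j c. x j = Some c \<longrightarrow> c \<in> components g)"
proof -
  have "o' \<in> Rcomp g \<longleftrightarrow> (\<forall>c. o' = Some c \<longrightarrow> c \<in> components g)" for o'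
    by (cases o') (auto simp: Rcomp_def components_def)
  then show ?thesis by (auto simp: Rinf_def support_def)
qed

lemma Rinf_comp_at:
  assumes x: "x \<in> Rinf g" and p: "p \<in> {1..num_comps x}"
  shows "comp_at x p \<in> components g"
proof -
  have "pos x p \<in> support x" using pos_in_support[of x p] x p by (auto simp: Rinf_iff)
  then show ?thesis using x by (auto simp: Rinf_iff support_def comp_at_def)
qed

lemma Rinf_upd:
  assumes x: "x \<in> Rinf g" and p: "p \<in> {1..num_comps x}" and y: "y \<in> components g"
  shows "x(pos x p := Some y) \<in> Rinf g"
  using x y support_upd[OF _ p, of y] by (auto simp: Rinf_iff)

lemma lookup_Rinf_wt:
  assumes x: "x \<in> Rinf g"
  shows "Poly_Mapping.lookup (Rinf_wt g x) k =
    (if k \<in> index_set g then \<Sum>q\<in>{1..num_comps x}. comp_coord g (comp_at x q) k else 0)"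
proof -
  have fin: "finite (support x)" and fi: "finite (index_set g)"
    using x by (auto simp: Rinf_iff index_set_def)
  have card: "int (card {j. x j \<in> (\<Union>s. Some ` Rset g i s)}) =
      (\<Sum>j\<in>support x. of_bool (fst (the (x j)) = i))" if "i \<in> index_set g" for i
  proof -
    have "(x j \<in> (\<Union>s. Some ` Rset g i s)) \<longleftrightarrow> j \<in> support x \<and> fst (the (x j)) = i" for j
    proof (cases "x j")
      case (Some c)
      then have "c \<in> components g" using x unfolding Rinf_iff by blast
      then obtain i' s where "c \<in> Rset g i' s" by (auto simp: components_def)
      moreover have "fst c = i''" if "c \<in> Rset g i'' s" for i'' s
        using that by (auto simp: Rset_def)
      ultimately show ?thesis using Some by (auto simp: support_def)
    qed (auto simp: support_def)
    then show ?thesis using fin by (simp add: Int_def)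
  qed
  have "Poly_Mapping.lookup (Rinf_wt g x) k =
      (\<Sum>i\<in>index_set g. int (card {j. x j \<in> (\<Union>s. Some ` Rset g i s)}) * of_bool (i = k))
      - (\<Sum>j\<in>support x. Poly_Mapping.lookup (rseq_wt g (the (x j))) k)"
    unfolding Rinf_wt_def lookup_minus lookup_sum lookup_frag_cmul fundamental_weight_def lookup_single
    by (simp add: when_def of_bool_def)
  also have "(\<Sum>i\<in>index_set g. int (card {j. x j \<in> (\<Union>s. Some ` Rset g i s)}) * of_bool (i = k)) =
      (if k \<in> index_set g then \<Sum>j\<in>support x. of_bool (fst (the (x j)) = k) else 0)"
  proof -
    have "(\<Sum>i\<in>index_set g. int (card {j. x j \<in> (\<Union>s. Some ` Rset g i s)}) * of_bool (i = k)) =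
        (\<Sum>i\<in>index_set g. if i = k then int (card {j. x j \<in> (\<Union>s. Some ` Rset g i s)}) else 0)"
      by (intro sum.cong) auto
    then show ?thesis using card[of k] fi by simp
  qed
  finally have "Poly_Mapping.lookup (Rinf_wt g x) k =
      (if k \<in> index_set g then \<Sum>j\<in>support x. comp_coord g (the (x j)) k else 0)"
    by (simp add: comp_coord_def sum_subtractf lookup_rseq_wt_outside)
  also have "(\<Sum>j\<in>support x. comp_coord g (the (x j)) k) =
      (\<Sum>q\<in>{1..num_comps x}. comp_coord g (comp_at x q) k)"
    using sum.reindex_bij_betw[OF pos_bij[OF fin], of "\<lambda>j. comp_coord g (the (x j)) k"]
    by (simp add: comp_at_def)
  finally show ?thesis .
qed

lemma Rinf_phi_minus_eps:
  assumes x: "x \<in> Rinf g" and l: "l \<in> index_set g"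
  shows "Rinf_phi g l x = Rinf_eps g l x + Fin (coroot_pairing l (Rinf_wt g x))"
proof (cases "num_comps x = 0")
  case True
  then show ?thesis
    using lookup_Rinf_wt[OF x] by (simp add: Rinf_eps_def Rinf_phi_def coroot_pairing_def)
next
  case False
  then have k: "1 \<le> num_comps x" by simp
  have "Poly_Mapping.lookup (Rinf_wt g x) l = (\<Sum>q\<in>{1..num_comps x}.
      int (comp_phi g l (comp_at x q)) - int (comp_eps g l (comp_at x q)))"
    using l comp_phi_minus_eps[OF Rinf_comp_at[OF x] l] by (simp add: lookup_Rinf_wt[OF x])
  also have "\<dots> = height g l x (num_comps x) + int (comp_phi g l (comp_at x (num_comps x)))"
    using k sum.last_plus[of 1 "num_comps x" "\<lambda>q. int (comp_phi g l (comp_at x q))"]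
    by (simp add: height_def sum_subtractf)
  finally show ?thesis
    using False by (simp add: Rinf_eps_eq Rinf_phi_eq coroot_pairing_def)
qed

text \<open>
  At the rightmost minimum \<open>p\<close>, the height increases to \<open>p + 1\<close>, so the component there has
  \<open>\<phi> > 0\<close>, unless \<open>p\<close> is the last position, where \<open>\<phi>\<close> of the component is \<open>\<phi>\<close> of the whole.
\<close>

lemma Rinf_f_eq_None_iff:
  assumes x: "x \<in> Rinf g" and l: "l \<in> index_set g"
  shows "Rinf_f g l x = None \<longleftrightarrow> Rinf_phi g l x = Fin 0"
proof (cases "num_comps x = 0")
  case True
  then show ?thesis by (simp add: Rinf_f_def Rinf_phi_def)
next
  case False
  then have k: "0 < num_comps x" by simp
  let ?k = "num_comps x" and ?p = "f_index g l x" and ?H = "height g l x"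
  note p = f_index[OF k, where g = g and l = l]
  let ?t = "?H ?k + int (comp_phi g l (comp_at x ?k)) - height_min g l x"
  have "comp_phi g l (comp_at x ?p) = 0 \<longleftrightarrow> ?t = 0"
  proof (cases "?p = ?k")
    case True
    then show ?thesis using p(2) by simp
  next
    case False
    then have lt: "?p < ?k" using p(1) by auto
    have "?t > 0" using p(3)[of ?k] lt k by auto
    moreover have "comp_phi g l (comp_at x ?p) \<noteq> 0"
      using p(1,2) p(3)[of "Suc ?p"] height_Suc[of ?p g l x] lt by auto
    ultimately show ?thesis by simp
  qed
  then show ?thesis
    using False by (simp add: Rinf_f_def Let_def theta_eq_None_iff Rinf_phi_eq)
qed

lemma Rinf_e_eq_None_iff:
  assumes x: "x \<in> Rinf g" and l: "l \<in> index_set g"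
  shows "Rinf_e g l x = None \<longleftrightarrow> Rinf_eps g l x = Fin 0"
proof (cases "num_comps x = 0")
  case True
  then show ?thesis by (simp add: Rinf_e_def Rinf_eps_def)
next
  case False
  then have k: "0 < num_comps x" by simp
  let ?p = "e_index g l x" and ?H = "height g l x"
  note p = e_index[OF k, where g = g and l = l]
  have "comp_eps g l (comp_at x ?p) = 0 \<longleftrightarrow> height_min g l x = 0"
  proof (cases "?p = 1")
    case True
    then show ?thesis using p(2) height_1[of g l x] by simp
  next
    case False
    then have lt: "1 < ?p" using p(1) by auto
    have "height_min g l x < 0" using p(3)[of 1] lt k height_1[of g l x] by auto
    moreover obtain q where "?p = Suc q" "1 \<le> q" using lt by (cases ?p) auto
    then have "comp_eps g l (comp_at x ?p) \<noteq> 0"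
      using p(1,2) p(3)[of q] height_Suc[of q g l x] by auto
    ultimately show ?thesis by simp
  qed
  then show ?thesis
    using False by (simp add: Rinf_e_def Let_def rho_eq_None_iff Rinf_eps_eq)
qed

text \<open>
  To the right of the rightmost minimum \<open>p\<close> the heights exceed the minimum by at least \<open>1\<close>. The
  action at \<open>p\<close> lowers them by \<open>2\<close> and the height at \<open>p\<close> by \<open>1\<close>, so the new minimum is smaller by
  \<open>1\<close> and \<open>p\<close> is its leftmost position. Hence the inverse operator acts at the same position.
\<close>

lemma Rinf_f_Some:
  assumes x: "x \<in> Rinf g" and l: "l \<in> index_set g" and f: "Rinf_f g l x = Some y"
  shows "y \<in> Rinf g" "Rinf_wt g y = Rinf_wt g x - simple_root g l"
    and "Rinf_eps g l y = Rinf_eps g l x + Fin 1" "Rinf_phi g l y = Rinf_phi g l x - Fin 1"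
    and "Rinf_e g l y = Some x"
proof -
  have k: "0 < num_comps x" using f by (auto simp: Rinf_f_def split: if_splits)
  define p where "p = f_index g l x"
  note p = f_index[OF k, where g = g and l = l, folded p_def]
  define c where "c = comp_at x p"
  obtain d where d: "theta g l c = Some d" and y: "y = x(pos x p := Some d)"
    using f k by (auto simp: Rinf_f_def Let_def p_def c_def)
  have fin: "finite (support x)" using x by (simp add: Rinf_iff)
  have cc: "c \<in> components g" unfolding c_def by (rule Rinf_comp_at[OF x p(1)])
  note t = theta_Some[OF cc l d]
  have ny: "num_comps y = num_comps x" unfolding y by (rule num_comps_upd[OF fin p(1)])
  have cy: "comp_at y q = (if q = p then d else comp_at x q)" if "q \<in> {1..num_comps x}" for q
    unfolding y by (rule comp_at_upd[OF fin p(1) that])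
  have H: "height g l y j = height g l x j - (if j < p then 0 else if j = p then 1 else 2)"
    if "j \<in> {1..num_comps x}" for j
    unfolding y using height_upd[OF fin p(1), where d = 1, OF _ _ that] t(3,4) by (simp add: c_def)
  show yR: "y \<in> Rinf g" unfolding y by (rule Rinf_upd[OF x p(1) t(1)])
  show wt: "Rinf_wt g y = Rinf_wt g x - simple_root g l"
  proof (rule poly_mapping_eqI)
    fix k
    have "(\<Sum>q\<in>{1..num_comps x}. comp_coord g (comp_at y q) k) =
        (\<Sum>q\<in>{1..num_comps x}. comp_coord g (comp_at x q) k
          - (if q = p then Poly_Mapping.lookup (simple_root g l) k else 0))"
      using comp_coord_theta[OF cc l d, of k] by (intro sum.cong) (auto simp: cy c_def)
    also have "\<dots> = (\<Sum>q\<in>{1..num_comps x}. comp_coord g (comp_at x q) k)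
        - Poly_Mapping.lookup (simple_root g l) k"
      using p(1) by (simp add: sum_subtractf)
    finally show "Poly_Mapping.lookup (Rinf_wt g y) k = Poly_Mapping.lookup (Rinf_wt g x - simple_root g l) k"
      unfolding lookup_minus lookup_Rinf_wt[OF x] lookup_Rinf_wt[OF yR] ny
      by (simp add: lookup_simple_root)
  qed
  have Hp: "height g l y p = height_min g l x - 1" using H[OF p(1)] p(2) by simp
  \<comment> \<open>Strict inequality to the left and weak inequality everywhere make \<open>p\<close> the leftmost minimum.\<close>
  have lower: "height g l y p < height g l y j" if "j \<in> {1..num_comps x}" "j < p" for j
    using H[OF that(1)] Hp that(2) height_min_le[OF that(1), of g l] by simp
  have upper: "height g l y p \<le> height g l y j" if "j \<in> {1..num_comps x}" for j
    using H[OF that] Hp lower[OF that] p(3)[OF that] by (cases j p rule: linorder_cases) auto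
  have m: "height_min g l y = height_min g l x - 1"
    unfolding Hp[symmetric] by (rule height_min_eqI) (use p(1) upper ny in auto)
  have e: "e_index g l y = p"
    by (rule e_index_eqI) (use p(1) upper lower ny in auto)
  show eps: "Rinf_eps g l y = Rinf_eps g l x + Fin 1"
    using k m ny by (simp add: Rinf_eps_eq)
  have "cartan g l l = 2" by (simp add: cartan_def)
  then show "Rinf_phi g l y = Rinf_phi g l x - Fin 1"
    using k m ny l unfolding Rinf_phi_minus_eps[OF x l] Rinf_phi_minus_eps[OF yR l] wt
    by (simp add: Rinf_eps_eq coroot_pairing_def lookup_minus lookup_simple_root)
  have "pos y p = pos x p" unfolding y by (rule pos_upd[OF fin p(1)])
  then have "y(pos y p := Some c) = x"
    unfolding y c_def using upd_comp_at[OF fin p(1)] by simp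
  then show "Rinf_e g l y = Some x"
    using k ny cy[OF p(1)] t(5) by (simp add: Rinf_e_def Let_def e)
qed

lemma Rinf_e_Some:
  assumes x: "x \<in> Rinf g" and l: "l \<in> index_set g" and e: "Rinf_e g l x = Some y"
  shows "y \<in> Rinf g" "Rinf_f g l y = Some x"
proof -
  have k: "0 < num_comps x" using e by (auto simp: Rinf_e_def split: if_splits)
  define p where "p = e_index g l x"
  note p = e_index[OF k, where g = g and l = l, folded p_def]
  define c where "c = comp_at x p"
  obtain d where d: "rho g l c = Some d" and y: "y = x(pos x p := Some d)"
    using e k by (auto simp: Rinf_e_def Let_def p_def c_def)
  have fin: "finite (support x)" using x by (simp add: Rinf_iff)
  have cc: "c \<in> components g" unfolding c_def by (rule Rinf_comp_at[OF x p(1)])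
  note r = rho_Some[OF cc l d]
  note t = theta_Some(3,4)[OF r(1) l r(2)]
  have ny: "num_comps y = num_comps x" unfolding y by (rule num_comps_upd[OF fin p(1)])
  have cy: "comp_at y p = d"
    unfolding y using comp_at_upd[OF fin p(1) p(1)] by simp
  have H: "height g l y j = height g l x j + (if j < p then 0 else if j = p then 1 else 2)"
    if "j \<in> {1..num_comps x}" for j
    unfolding y using height_upd[OF fin p(1), where d = "-1", OF _ _ that] t by (simp add: c_def)
  show "y \<in> Rinf g" unfolding y by (rule Rinf_upd[OF x p(1) r(1)])
  have Hp: "height g l y p = height_min g l x + 1" using H[OF p(1)] p(2) by simp
  have upper: "height g l y p < height g l y j" if "j \<in> {1..num_comps x}" "p < j" for j
    using H[OF that(1)] Hp that(2) height_min_le[OF that(1), of g l] by simp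
  have lower: "height g l y p \<le> height g l y j" if "j \<in> {1..num_comps x}" for j
    using H[OF that] Hp upper[OF that] p(3)[OF that] by (cases j p rule: linorder_cases) auto
  have i: "f_index g l y = p"
    by (rule f_index_eqI) (use p(1) upper lower ny in auto)
  have "pos y p = pos x p" unfolding y by (rule pos_upd[OF fin p(1)])
  then have "y(pos y p := Some c) = x"
    unfolding y c_def using upd_comp_at[OF fin p(1)] by simp
  then show "Rinf_f g l y = Some x"
    using k ny cy r(2) by (simp add: Rinf_f_def Let_def i)
qed

lemma Rinf_nonneg:
  "\<exists>m. Rinf_eps g l x = Fin (int m)" "\<exists>m. Rinf_phi g l x = Fin (int m)"
proof -
  have "(\<exists>m. Rinf_eps g l x = Fin (int m)) \<and> (\<exists>m. Rinf_phi g l x = Fin (int m))"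
  proof (cases "num_comps x = 0")
    case True
    then have "Rinf_eps g l x = Fin (int 0)" "Rinf_phi g l x = Fin (int 0)"
      by (simp_all add: Rinf_eps_def Rinf_phi_def)
    then show ?thesis by blast
  next
    case False
    then have k: "0 < num_comps x" by simp
    let ?t = "height g l x (num_comps x) + int (comp_phi g l (comp_at x (num_comps x)))
      - height_min g l x"
    have "height_min g l x \<le> 0" "height_min g l x \<le> height g l x (num_comps x)"
      using height_min_le[of 1 x g l] height_min_le[of "num_comps x" x g l] k height_1[of g l x] by auto
    then have "Rinf_eps g l x = Fin (int (nat (- height_min g l x)))"
      "Rinf_phi g l x = Fin (int (nat ?t))"
      using k by (simp_all add: Rinf_eps_eq Rinf_phi_eq)
    then show ?thesis by blast
  qed
  then show "\<exists>m. Rinf_eps g l x = Fin (int m)" "\<exists>m. Rinf_phi g l x = Fin (int m)" by blast+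
qed

theorem proposition3p1p1:
  fixes g :: cartan_type
  assumes "lie_rank g \<ge> 1"
  shows "semiregular_crystal g (Rinf g) (Rinf_wt g) (Rinf_e g) (Rinf_f g)
           (Rinf_eps g) (Rinf_phi g)"
proof unfold_locales
  fix x assume x: "x \<in> Rinf g"
  show "Rinf_wt g x \<in> weight_lattice g"
    using lookup_Rinf_wt[OF x] by (auto simp: weight_lattice_def in_keys_iff split: if_splits)
next
  fix l x assume l: "l \<in> index_set g" and x: "x \<in> Rinf g"
  show "Rinf_eps g l x \<noteq> Pinf" "Rinf_phi g l x \<noteq> Pinf"
    by (simp_all add: Rinf_eps_def Rinf_phi_def)
  show "Rinf_phi g l x = Rinf_eps g l x + Fin (coroot_pairing l (Rinf_wt g x))"
    by (rule Rinf_phi_minus_eps[OF x l])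
  show "Rinf_e g l x = None \<and> Rinf_f g l x = None" if "Rinf_phi g l x = Minf"
    using that by (simp add: Rinf_phi_def split: if_splits)
  show "Rinf_f g l x = Some y \<longleftrightarrow> Rinf_e g l y = Some x" if "y \<in> Rinf g" for y
    using Rinf_f_Some(5)[OF x l] Rinf_e_Some(2)[OF that l] by blast
  show "has_max_value (Rinf_eps g l x) {k. iterate_op (Rinf_e g l) k x \<noteq> None}"
  proof -
    obtain m where m: "Rinf_eps g l x = Fin (int m)" using Rinf_nonneg(1) by blast
    have step: "z \<in> Rinf g \<and> Rinf_eps g l z = Rinf_eps g l y - Fin 1"
      if y: "y \<in> Rinf g" "Rinf_e g l y = Some z" for y z
    proof -
      have z: "z \<in> Rinf g" "Rinf_f g l z = Some y" using Rinf_e_Some[OF y(1) l y(2)] by auto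
      obtain k where "Rinf_eps g l z = Fin (int k)" using Rinf_nonneg(1) by blast
      then show ?thesis using z Rinf_f_Some(3)[OF z(1) l z(2)] by simp
    qed
    show ?thesis
      by (rule has_max_value_iterate[of x "Rinf g" "Rinf_eps g l" m "Rinf_e g l"])
        (use x m step Rinf_e_eq_None_iff[OF _ l] in auto)
  qed
  show "has_max_value (Rinf_phi g l x) {k. iterate_op (Rinf_f g l) k x \<noteq> None}"
  proof -
    obtain m where m: "Rinf_phi g l x = Fin (int m)" using Rinf_nonneg(2) by blast
    show ?thesis
      by (rule has_max_value_iterate[of x "Rinf g" "Rinf_phi g l" m "Rinf_f g l"])
        (use x m Rinf_f_Some(1,4)[OF _ l] Rinf_f_eq_None_iff[OF _ l] in auto)
  qed
  fix y
  show "y \<in> Rinf g" "Rinf_wt g y = Rinf_wt g x - simple_root g l"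
    "Rinf_eps g l y = Rinf_eps g l x + Fin 1" "Rinf_phi g l y = Rinf_phi g l x - Fin 1"
    if "Rinf_f g l x = Some y"
    using Rinf_f_Some[OF x l that] by blast+
  assume e: "Rinf_e g l x = Some y"
  note y = Rinf_e_Some[OF x l e]
  note f = Rinf_f_Some[OF y(1) l y(2)]
  show "y \<in> Rinf g" by (rule y(1))
  show "Rinf_wt g y = Rinf_wt g x + simple_root g l" using f(2) by simp
  obtain a b where "Rinf_eps g l y = Fin a" "Rinf_phi g l y = Fin b"
    using Rinf_nonneg[of g l y] by blast
  then show "Rinf_eps g l y = Rinf_eps g l x - Fin 1" "Rinf_phi g l y = Rinf_phi g l x + Fin 1"
    using f(3,4) Rinf_nonneg(2)[of g l x] by auto
qed

end
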